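(* For every real number $\varepsilon > 0$ and every Hamiltonian graph $F$, there exists a constant $C = C(F,\varepsilon) > 0$ such that the following holds. For all positive integers $n$ and $m$ with $n$ divisible by $|V(F)|$ and $m \geq Cn$, $$N_F(n,m) \leq \left[(1+\varepsilon)\left(\frac{|V(F)|}{|\mathrm{Aut}(F)|}\right)^{\frac{1}{|V(F)|-1}} \frac{2m}{en}\right]^{\left(1-\frac{1}{|V(F)|}\right)n}.$$ Moreover, this bound is asymptotically sharp for infinitely many pairs $(n,m)$: for every $\delta\in(0,1)$ there are infinitely many pairs $(n,m)$ of positive integers with $n$ divisible by $|V(F)|$ and $m\ge Cn$ such that $$N_F(n,m) \geq \left[(1-\delta)\left(\frac{|V(F)|}{|\mathrm{Aut}(F)|}\right)^{\frac{1}{|V(F)|-1}} \frac{2m}{en}\right]^{\left(1-\frac{1}{|V(F)|}\right)n}.$$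
   Context: All graphs are finite and simple. $\mathrm{Aut}(F)$ is the automorphism group of $F$ and $e$ is Euler's number. An $F$-factor of a graph $G$ is a spanning subgraph of $G$ that is a vertex-disjoint union of copies of $F$. $N_F(n,m)$ denotes the maximum number of distinct $F$-factors in $G$ over all graphs $G$ with exactly $n$ vertices and exactly $m$ edges (taken to be $0$ if no such graph exists). A graph $F$ on $\ell$ vertices is Hamiltonian if it contains the cycle $C_\ell$ as a spanning subgraph; by convention $C_2$ is a single edge, so $K_2$ is included (here $\ell\ge 2$). *)

theory Defs
  imports Complex_Main "HOL-Combinatorics.Permutations" "HOL-Library.Disjoint_Sets"
begin

type_synonym 'a sgraph = "'a set \<times> 'a set set"

abbreviation verts :: "'a sgraph \<Rightarrow> 'a set" where "verts \<equiv> fst"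
abbreviation edges :: "'a sgraph \<Rightarrow> 'a set set" where "edges \<equiv> snd"

definition simple_graph :: "'a sgraph \<Rightarrow> bool" where
  "simple_graph G \<longleftrightarrow> finite (verts G) \<and> (\<forall>e\<in>edges G. e \<subseteq> verts G \<and> card e = 2)"

definition spanning_subgraph :: "'a sgraph \<Rightarrow> 'a sgraph \<Rightarrow> bool" where
  "spanning_subgraph H G \<longleftrightarrow> verts H = verts G \<and> edges H \<subseteq> edges G"

definition isomorphic :: "'a sgraph \<Rightarrow> 'b sgraph \<Rightarrow> bool" where
  "isomorphic G H \<longleftrightarrow>
     (\<exists>f. bij_betw f (verts G) (verts H) \<and> edges H = (\<lambda>e. f ` e) ` edges G)"

definition Aut :: "'a sgraph \<Rightarrow> ('a \<Rightarrow> 'a) set" where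
  "Aut F = {p. p permutes verts F \<and> (\<lambda>e. p ` e) ` edges F = edges F}"

text \<open>For \<open>l = 2\<close> the two index pairs give the same edge, so this is a single edge,
  in agreement with the convention for \<open>C\<^sub>2\<close>.\<close>
definition cycle_graph :: "nat \<Rightarrow> nat sgraph" where
  "cycle_graph l = ({..<l}, {{i, Suc i mod l} | i. i < l})"

definition hamiltonian :: "'a sgraph \<Rightarrow> bool" where
  "hamiltonian F \<longleftrightarrow> card (verts F) \<ge> 2 \<and>
     (\<exists>H. spanning_subgraph H F \<and> isomorphic (cycle_graph (card (verts F))) H)"

definition is_factor :: "'a sgraph \<Rightarrow> 'b sgraph \<Rightarrow> 'b sgraph \<Rightarrow> bool" where
  "is_factor F G H \<longleftrightarrow> spanning_subgraph H G \<and>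
     (\<exists>\<D>. (\<forall>D\<in>\<D>. isomorphic F D) \<and> disjoint_family_on verts \<D> \<and>
          verts H = (\<Union>D\<in>\<D>. verts D) \<and> edges H = (\<Union>D\<in>\<D>. edges D))"

definition num_factors :: "'a sgraph \<Rightarrow> 'b sgraph \<Rightarrow> nat" where
  "num_factors F G = card {H. is_factor F G H}"

definition factor_counts :: "'a sgraph \<Rightarrow> nat \<Rightarrow> nat \<Rightarrow> nat set" where
  "factor_counts F n m =
     {num_factors F G | G :: nat sgraph.
        simple_graph G \<and> card (verts G) = n \<and> card (edges G) = m}"

text \<open>The extremal number \<open>N\<^sub>F(n,m)\<close>. Restricting to graphs whose vertices are natural
  numbers loses nothing, since every finite graph is isomorphic to such a graph; the lemmas
  below show that the maximum is taken over a finite set.\<close>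
definition max_factors :: "'a sgraph \<Rightarrow> nat \<Rightarrow> nat \<Rightarrow> nat" where
  "max_factors F n m = (if factor_counts F n m = {} then 0 else Max (factor_counts F n m))"

lemma simple_graph_finite_edges: "simple_graph G \<Longrightarrow> finite (edges G)"
  unfolding simple_graph_def by (meson PowI finite_Pow_iff finite_subset subsetI)

lemma factors_subset: "{H. is_factor F G H} \<subseteq> {verts G} \<times> Pow (edges G)"
  by (auto simp: is_factor_def spanning_subgraph_def)

lemma finite_factors: "simple_graph G \<Longrightarrow> finite {H. is_factor F G H}"
  by (rule finite_subset[OF factors_subset]) (simp add: simple_graph_finite_edges)

lemma finite_factor_counts: "finite (factor_counts F n m)"
proof (rule finite_subset)
  show "factor_counts F n m \<subseteq> {..2 ^ m}"
  proof
    fix k assume "k \<in> factor_counts F n m"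
    then obtain G :: "nat sgraph" where G: "simple_graph G" "card (edges G) = m"
      and k: "k = card {H. is_factor F G H}"
      by (auto simp: factor_counts_def num_factors_def)
    have "k \<le> card ({verts G} \<times> Pow (edges G))"
      unfolding k using simple_graph_finite_edges[OF G(1)]
      by (intro card_mono factors_subset) auto
    also have "\<dots> = 2 ^ m"
      using G simple_graph_finite_edges[OF G(1)] by (simp add: card_cartesian_product card_Pow)
    finally show "k \<in> {..2 ^ m}" by simp
  qed
qed simp

end

theory Submission
  imports Defs "HOL-Real_Asymp.Real_Asymp"
begin

text \<open>
Let \<open>l\<close> be the number of vertices of \<open>F\<close>, let \<open>n = l K\<close> and let \<open>d = 2 m / n\<close> be the average degree.
Label the vertices of \<open>F\<close> along a Hamilton cycle. A copy of \<open>F\<close> in a graph can then be written, in as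
many ways as \<open>F\<close> has automorphisms, as an \<open>l\<close>-tuple of vertices that runs round a closed walk, and a
factor as a set of \<open>K\<close> such tuples that partition the vertices, a tiling. As the tiling determines
the factor, the number of factors times \<open>card (Aut F) ^ K\<close> is at most the number of tilings
(\<open>num_factors_le_tilings\<close>). What remains of \<open>F\<close> is its Hamilton cycle, and it is to be shown that
there are at most about \<open>l ^ K * (d / e) ^ ((l - 1) K)\<close> tilings.

This is done by an entropy argument in the style of the proofs of Bregman's bound for permanents.
Consider the random process that repeatedly chooses a random uncovered vertex and a random position
for it in its tuple, completes the tuple by a random walk along uncovered neighbours, and declares
the tuple covered. The probabilities of the tilings sum to at most one. For a fixed tiling \<open>T\<close>, by
convexity, the probability of \<open>T\<close> is at least the exponential of its average logarithm over the
orders in which the tuples of \<open>T\<close> can appear. These orders are uniformly distributed, and so is the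
starting position in each tuple; hence when \<open>j\<close> other tuples are uncovered, a vertex has on
average at most \<open>l + j d / (K - 1)\<close> uncovered neighbours to choose from. The number of tilings is thus
at most \<open>l ^ K\<close> times the product over \<open>j < K\<close> of \<open>(l + j d / (K - 1)) ^ (l - 1)\<close>
(\<open>sum_tiling_weights_le_1\<close>, \<open>card_tilings_le\<close>). No order is chosen explicitly: the average over it is
built into the induction, one removed tuple at a time (\<open>log_bound_recursion\<close>).

The logarithm of the product of the \<open>l + j d / (K - 1)\<close> is close to \<open>K\<close> times the integral of
\<open>ln (d x)\<close> over \<open>x\<close> from \<open>0\<close> to \<open>1\<close>, that is \<open>K (ln d - 1)\<close>, which gives \<open>(d / e) ^ K\<close>. The relative error is
governed by \<open>l / d + 1 / K\<close>, which is small once \<open>m \<ge> C n\<close> (\<open>prod_arithmetic_le\<close>).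

Complete graphs attain the bound asymptotically. As \<open>F\<close> is connected, removing the component of a fixed vertex
gives a recursion for the number of factors, with the solution
\<open>fact n / (fact K * card (Aut F) ^ K)\<close> (\<open>num_factors_complete_ge\<close>), and Stirling's formula finishes
the proof.
\<close>

section \<open>Jensen's inequality for the logarithm and the exponential function\<close>

lemma sum_ln_le_ln_mean:
  fixes x :: "'a \<Rightarrow> real"
  assumes "finite A" "A \<noteq> {}" "\<And>i. i \<in> A \<Longrightarrow> x i > 0"
  shows "(\<Sum>i\<in>A. ln (x i)) \<le> real (card A) * ln ((\<Sum>i\<in>A. x i) / real (card A))"
proof -
  define n where "n = real (card A)"
  define c where "c = (\<Sum>i\<in>A. x i) / n"
  have n: "n > 0" using assms by (simp add: n_def card_gt_0_iff)
  have pos: "(\<Sum>i\<in>A. x i) > 0" using assms by (intro sum_pos) auto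
  then have c: "c > 0" using n by (simp add: c_def)
  \<comment> \<open>The tangent of the logarithm at the mean \<open>c\<close>.\<close>
  have "ln (x i) \<le> ln c + (x i / c - 1)" if "i \<in> A" for i
    using ln_le_minus_one[of "x i / c"] assms(3)[OF that] c by (simp add: ln_div)
  then have "(\<Sum>i\<in>A. ln (x i)) \<le> (\<Sum>i\<in>A. ln c + (x i / c - 1))"
    by (rule sum_mono)
  also have "\<dots> = n * ln c + ((\<Sum>i\<in>A. x i) / c - n)"
    by (simp add: sum.distrib sum_subtractf sum_divide_distrib n_def)
  also have "(\<Sum>i\<in>A. x i) / c = n" using n pos by (simp add: c_def)
  finally show ?thesis by (simp add: n_def c_def)
qed

lemma exp_mean_le_mean_exp:
  fixes x :: "'a \<Rightarrow> real"
  assumes "finite A" "A \<noteq> {}"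
  shows "exp ((\<Sum>i\<in>A. x i) / real (card A)) \<le> (\<Sum>i\<in>A. exp (x i)) / real (card A)"
proof -
  define n where "n = real (card A)"
  define c where "c = (\<Sum>i\<in>A. x i) / n"
  have n: "n > 0" using assms by (simp add: n_def card_gt_0_iff)
  \<comment> \<open>The tangent of the exponential function at the mean \<open>c\<close>.\<close>
  have le: "exp c * (1 + (x i - c)) \<le> exp (x i)" for i
  proof -
    have "exp c * (1 + (x i - c)) \<le> exp c * exp (x i - c)"
      by (intro mult_left_mono exp_ge_add_one_self) simp
    then show ?thesis by (simp add: exp_diff)
  qed
  have "n * exp c = exp c * (n + ((\<Sum>i\<in>A. x i) - n * c))" using n by (simp add: c_def)
  also have "\<dots> = (\<Sum>i\<in>A. exp c * (1 + (x i - c)))"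
    by (simp add: sum_distrib_left[symmetric] sum.distrib sum_subtractf n_def)
  also have "\<dots> \<le> (\<Sum>i\<in>A. exp (x i))" using le by (rule sum_mono)
  finally show ?thesis using n by (simp add: c_def n_def field_simps)
qed

section \<open>Random walks and closed walks\<close>

text \<open>Edges are unordered pairs in a set \<open>E\<close>; degrees are always taken inside a varying vertex set \<open>U\<close>.\<close>

abbreviation nbrs :: "'b set set \<Rightarrow> 'b set \<Rightarrow> 'b \<Rightarrow> 'b set" where
  "nbrs E U u \<equiv> {w \<in> U. {u, w} \<in> E}"

definition walks :: "'b set set \<Rightarrow> 'b set \<Rightarrow> nat \<Rightarrow> 'b \<Rightarrow> 'b list set" where
  "walks E U l u = {t. length t = l \<and> l > 0 \<and> t ! 0 = u \<and> set t \<subseteq> U \<and>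
     (\<forall>j. Suc j < l \<longrightarrow> {t ! j, t ! Suc j} \<in> E)}"

lemma finite_walks: "finite U \<Longrightarrow> finite (walks E U l u)"
  by (rule finite_subset[OF _ finite_lists_length_eq[of U l]]) (auto simp: walks_def)

lemma walks_nth_0: "t \<in> walks E U l u \<Longrightarrow> t ! 0 = u"
  by (simp add: walks_def)

lemma walks_Suc:
  assumes "u \<in> U" "0 < l"
  shows "walks E U (Suc l) u = (\<Union>v\<in>nbrs E U u. (#) u ` walks E U l v)" (is "?L = ?R")
proof (rule set_eqI)
  fix t show "t \<in> ?L \<longleftrightarrow> t \<in> ?R"
  proof
    assume t: "t \<in> ?L"
    then have "length t = Suc l" "t ! 0 = u" by (simp_all add: walks_def)
    then obtain s where s: "t = u # s" "length s = l"
      by (cases t) simp_all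
    have st: "{t ! j, t ! Suc j} \<in> E" if "j < l" for j using t that by (auto simp: walks_def)
    have "{s ! j, s ! Suc j} \<in> E" if "Suc j < l" for j using st[OF that] s by simp
    moreover have "set s \<subseteq> U" using t s by (simp add: walks_def)
    ultimately have "s \<in> walks E U l (s ! 0)" using s assms by (simp add: walks_def)
    moreover have "{u, s ! 0} \<in> E" using st[of 0] s assms by simp
    moreover have "s ! 0 \<in> U" using \<open>set s \<subseteq> U\<close> s assms nth_mem[of 0 s] by auto
    ultimately have "s ! 0 \<in> nbrs E U u" "s \<in> walks E U l (s ! 0)" by simp_all
    with s show "t \<in> ?R" by blast
  next
    assume "t \<in> ?R"
    then obtain v s where v: "v \<in> nbrs E U u" "s \<in> walks E U l v" "t = u # s" by blast
    have "{t ! j, t ! Suc j} \<in> E" if "Suc j < Suc l" for j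
      using v that by (cases j) (auto simp: walks_def)
    with v assms show "t \<in> ?L" by (auto simp: walks_def)
  qed
qed

text \<open>The product is the probability that a random walk in \<open>U\<close> that starts at \<open>u\<close> and moves each time to
a uniformly random neighbour runs through \<open>t\<close>, so the sum is the probability that this walk does
not get stuck.\<close>

lemma sum_walks_le_1:
  assumes U: "finite U" and "0 < l" "u \<in> U"
  shows "(\<Sum>t\<in>walks E U l u. \<Prod>j<l - 1. 1 / real (card (nbrs E U (t ! j)))) \<le> 1"
  using assms(2,3)
proof (induction l arbitrary: u rule: nat_induct_non_zero)
  case 1
  have "walks E U 1 u \<subseteq> {[u]}"
    by (auto simp: walks_def length_Suc_conv)
  from card_mono[OF _ this] show ?case by simp
next
  case (Suc l)
  let ?w = "\<lambda>t. \<Prod>j<l - 1. 1 / real (card (nbrs E U (t ! j)))"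
  let ?d = "real (card (nbrs E U u))"
  have w: "(\<Prod>j<l. 1 / real (card (nbrs E U ((u # t) ! j)))) = 1 / ?d * ?w t" for t
    using \<open>0 < l\<close> by (cases l) (simp_all add: prod.lessThan_Suc_shift del: prod.lessThan_Suc)
  have "(\<Sum>t\<in>walks E U (Suc l) u. \<Prod>j<l. 1 / real (card (nbrs E U (t ! j))))
      \<le> (\<Sum>v\<in>nbrs E U u. \<Sum>t\<in>(#) u ` walks E U l v. \<Prod>j<l. 1 / real (card (nbrs E U (t ! j))))"
    unfolding walks_Suc[OF \<open>u \<in> U\<close> \<open>0 < l\<close>] using U
    by (subst sum.UNION_disjoint) (auto simp: finite_walks dest: walks_nth_0)
  also have "\<dots> = (\<Sum>v\<in>nbrs E U u. \<Sum>t\<in>walks E U l v. 1 / ?d * ?w t)"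
    by (subst sum.reindex) (simp_all add: o_def w)
  also have "\<dots> \<le> (\<Sum>v\<in>nbrs E U u. 1 / ?d * 1)"
    unfolding sum_distrib_left[symmetric] 
    by (intro sum_mono mult_left_mono Suc.IH) auto
  also have "\<dots> \<le> 1" by simp
  finally show ?case by simp
qed

text \<open>The tuples of distinct vertices that run round a closed walk of length \<open>l\<close>. The
same cycle gives several tuples, with different first vertices and orientations.\<close>

definition ham_tuples :: "'b set set \<Rightarrow> nat \<Rightarrow> 'b set \<Rightarrow> 'b list set" where
  "ham_tuples E l U = {t. length t = l \<and> distinct t \<and> set t \<subseteq> U \<and>
     (\<forall>i<l. {t ! i, t ! (Suc i mod l)} \<in> E)}"

lemma finite_ham_tuples: "finite U \<Longrightarrow> finite (ham_tuples E l U)"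
  by (rule finite_subset[OF _ finite_lists_length_eq[of U l]]) (auto simp: ham_tuples_def)

lemma rotate_ham_tuple:
  assumes "t \<in> ham_tuples E l U" "0 < l"
  shows "rotate i t \<in> walks E U l (rotate i t ! 0)"
proof -
  have "{rotate i t ! j, rotate i t ! Suc j} \<in> E" if "Suc j < l" for j
  proof -
    have "{t ! ((i + j) mod l), t ! (Suc ((i + j) mod l) mod l)} \<in> E"
      using assms by (auto simp: ham_tuples_def)
    then show ?thesis using assms that
      by (simp add: nth_rotate ham_tuples_def mod_Suc_eq)
  qed
  then show ?thesis using assms by (auto simp: walks_def ham_tuples_def)
qed

text \<open>Reading a tuple from position \<open>i\<close> onwards turns it into a walk, and different tuples become
different walks. The random walk bound for each of the possible first vertices then gives
\<open>card U\<close> in total.\<close>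

lemma sum_ham_tuples_le:
  assumes U: "finite U" and l: "0 < l"
  shows "(\<Sum>t\<in>ham_tuples E l U. \<Prod>j<l - 1. 1 / real (card (nbrs E U (t ! ((i + j) mod l))))) \<le> real (card U)"
proof -
  let ?w = "\<lambda>t. \<Prod>j<l - 1. 1 / real (card (nbrs E U (t ! j)))"
  have inj: "inj_on (rotate i) (ham_tuples E l U)"
    by (rule inj_on_subset[OF inj_fn[OF inj_rotate1, folded rotate_def]]) simp
  have "(\<Sum>t\<in>ham_tuples E l U. \<Prod>j<l - 1. 1 / real (card (nbrs E U (t ! ((i + j) mod l)))))
      = (\<Sum>t\<in>ham_tuples E l U. ?w (rotate i t))"
    by (intro sum.cong prod.cong refl) (auto simp: ham_tuples_def nth_rotate)
  also have "\<dots> = (\<Sum>t\<in>rotate i ` ham_tuples E l U. ?w t)"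
    by (simp add: sum.reindex[OF inj])
  also have "\<dots> \<le> (\<Sum>t\<in>(\<Union>u\<in>U. walks E U l u). ?w t)"
  proof (rule sum_mono2)
    show "rotate i ` ham_tuples E l U \<subseteq> (\<Union>u\<in>U. walks E U l u)"
    proof clarify
      fix t assume t: "t \<in> ham_tuples E l U"
      have "rotate i t ! 0 \<in> set (rotate i t)"
        using t l by (intro nth_mem) (simp add: ham_tuples_def)
      then have "rotate i t ! 0 \<in> U" using t by (auto simp: ham_tuples_def)
      with rotate_ham_tuple[OF t l] show "rotate i t \<in> (\<Union>u\<in>U. walks E U l u)" by blast
    qed
  qed (auto simp: finite_walks U intro: prod_nonneg)
  also have "\<dots> = (\<Sum>u\<in>U. \<Sum>t\<in>walks E U l u. ?w t)"
    by (rule sum.UNION_disjoint) (auto simp: U finite_walks dest: walks_nth_0)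
  also have "\<dots> \<le> (\<Sum>u\<in>U. 1)"
    by (intro sum_mono sum_walks_le_1 U l)
  finally show ?thesis by simp
qed

text \<open>Over all rotations every entry of the tuple is read equally often in the first \<open>k\<close> places. With
\<open>k = l - 1\<close> this is where the exponent \<open>1 - 1/l\<close> comes from: in a cycle of \<open>l\<close> vertices
only \<open>l - 1\<close> steps are free choices.\<close>

lemma sum_rotations:
  fixes f :: "'b \<Rightarrow> real"
  assumes "length t = l" "distinct t"
  shows "(\<Sum>i<l. \<Sum>j<k. f (t ! ((i + j) mod l))) = real k * (\<Sum>u\<in>set t. f u)"
proof -
  have "(\<Sum>i<l. f (t ! ((i + j) mod l))) = (\<Sum>u\<in>set t. f u)" for j
  proof -
    have "(\<Sum>i<l. f (t ! ((i + j) mod l))) = (\<Sum>i<l. f (rotate j t ! i))"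
      using assms by (intro sum.cong) (auto simp: nth_rotate add.commute)
    also have "\<dots> = sum_list (map f (rotate j t))"
      using assms by (simp add: sum_list_sum_nth atLeast0LessThan)
    also have "\<dots> = (\<Sum>u\<in>set t. f u)"
      using assms by (subst sum_list_distinct_conv_sum_set) auto
    finally show ?thesis .
  qed
  then show ?thesis by (subst sum.swap) simp
qed

section \<open>Tilings by closed walks\<close>

definition tilings :: "'b set set \<Rightarrow> nat \<Rightarrow> 'b set \<Rightarrow> 'b list set set" where
  "tilings E l U = {T. T \<subseteq> ham_tuples E l U \<and> disjoint_family_on set T \<and> (\<Union>t\<in>T. set t) = U}"

lemma tilings_finite: "finite U \<Longrightarrow> T \<in> tilings E l U \<Longrightarrow> finite T"
  unfolding tilings_def using finite_ham_tuples finite_subset by blast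

lemma finite_tilings: "finite U \<Longrightarrow> finite (tilings E l U)"
  by (rule finite_subset[of _ "Pow (ham_tuples E l U)"]) (auto simp: tilings_def finite_ham_tuples)

lemma card_tiling:
  assumes "finite U" "T \<in> tilings E l U"
  shows "card U = l * card T"
proof -
  have "card U = card (\<Union>t\<in>T. set t)" using assms by (simp add: tilings_def)
  also have "\<dots> = (\<Sum>t\<in>T. card (set t))"
    using tilings_finite[OF assms] assms(2)
    by (intro card_UN_disjoint) (auto simp: tilings_def disjoint_family_on_def)
  also have "\<dots> = (\<Sum>t\<in>T. l)"
    using assms by (intro sum.cong) (auto simp: tilings_def ham_tuples_def distinct_card)
  finally show ?thesis by simp
qed

lemma tiling_remove:
  assumes "T \<in> tilings E l U" "t \<in> T"
  shows "T - {t} \<in> tilings E l (U - set t)"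
proof -
  have disj: "set s \<inter> set t = {}" if "s \<in> T - {t}" for s
    using assms that by (auto simp: tilings_def disjoint_family_on_def)
  have "T - {t} \<subseteq> ham_tuples E l (U - set t)"
  proof
    fix s assume s: "s \<in> T - {t}"
    then have "s \<in> ham_tuples E l U" using assms by (auto simp: tilings_def)
    with disj[OF s] show "s \<in> ham_tuples E l (U - set t)" by (auto simp: ham_tuples_def)
  qed
  moreover have "(\<Union>s\<in>T - {t}. set s) = U - set t"
  proof -
    have "U = (\<Union>s\<in>T - {t}. set s) \<union> set t" using assms by (auto simp: tilings_def)
    with disj show ?thesis by blast
  qed
  moreover have "disjoint_family_on set (T - {t})"
    using assms by (auto simp: tilings_def disjoint_family_on_def)
  ultimately show ?thesis by (simp add: tilings_def)
qed

text \<open>Edges from \<open>s\<close> to \<open>t\<close>, counted by ordered pairs of end vertices, so that \<open>incidences E s s\<close> counts each edge inside \<open>s\<close> twice.\<close>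

definition incidences :: "'b set set \<Rightarrow> 'b list \<Rightarrow> 'b list \<Rightarrow> real" where
  "incidences E s t = (\<Sum>u\<in>set s. real (card (nbrs E (set t) u)))"

definition cross_degree :: "'b set set \<Rightarrow> 'b list set \<Rightarrow> real" where
  "cross_degree E T = (\<Sum>s\<in>T. \<Sum>t\<in>T - {s}. incidences E s t)"

lemma cross_degree_nonneg: "cross_degree E T \<ge> 0"
  by (auto simp: cross_degree_def incidences_def intro!: sum_nonneg)

text \<open>A pair of different tuples survives the removal of \<open>r\<close> unless \<open>r\<close> is one of the two, which happens
for all but two choices of \<open>r\<close>.\<close>

lemma sum_cross_degree_remove:
  assumes "finite T"
  shows "(\<Sum>r\<in>T. cross_degree E (T - {r})) = (real (card T) - 2) * cross_degree E T"
proof -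
  have "(\<Sum>r\<in>T. cross_degree E (T - {r}))
      = (\<Sum>r\<in>T. \<Sum>s\<in>T. \<Sum>t\<in>T - {s}. if r \<noteq> s \<and> r \<noteq> t then incidences E s t else 0)"
    unfolding cross_degree_def
  proof (rule sum.cong[OF refl])
    fix r assume r: "r \<in> T"
    have "(\<Sum>s\<in>T. \<Sum>t\<in>T - {s}. if r \<noteq> s \<and> r \<noteq> t then incidences E s t else 0)
       = (\<Sum>s\<in>T - {r}. \<Sum>t\<in>T - {s}. if r \<noteq> s \<and> r \<noteq> t then incidences E s t else 0)"
      using assms by (intro sum.mono_neutral_right) auto
    also have "\<dots> = (\<Sum>s\<in>T - {r}. \<Sum>t\<in>T - {r} - {s}. incidences E s t)"
      using assms by (intro sum.cong sum.mono_neutral_cong_right refl) auto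
    finally show "(\<Sum>s\<in>T - {r}. \<Sum>t\<in>T - {r} - {s}. incidences E s t)
       = (\<Sum>s\<in>T. \<Sum>t\<in>T - {s}. if r \<noteq> s \<and> r \<noteq> t then incidences E s t else 0)" by simp
  qed
  also have "\<dots> = (\<Sum>s\<in>T. \<Sum>t\<in>T - {s}. \<Sum>r\<in>T. if r \<noteq> s \<and> r \<noteq> t then incidences E s t else 0)"
    by (subst sum.swap) (rule sum.cong[OF refl], rule sum.swap)
  also have "\<dots> = (\<Sum>s\<in>T. \<Sum>t\<in>T - {s}. (real (card T) - 2) * incidences E s t)"
  proof (intro sum.cong refl)
    fix s t assume st: "s \<in> T" "t \<in> T - {s}"
    have "(\<Sum>r\<in>T. if r \<noteq> s \<and> r \<noteq> t then incidences E s t else 0) = (\<Sum>r\<in>T - {s,t}. incidences E s t)"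
      using assms by (intro sum.mono_neutral_cong_right) auto
    also have "\<dots> = real (card (T - {s,t})) * incidences E s t" by simp
    also have "real (card (T - {s,t})) = real (card T) - 2"
    proof -
      have "card {s,t} = 2" using st by auto
      moreover have "card {s,t} \<le> card T" using st assms by (intro card_mono) auto
      ultimately show ?thesis using st by (subst card_Diff_subset) auto
    qed
    finally show "(\<Sum>r\<in>T. if r \<noteq> s \<and> r \<noteq> t then incidences E s t else 0) = (real (card T) - 2) * incidences E s t" .
  qed
  also have "\<dots> = (real (card T) - 2) * cross_degree E T"
    by (simp add: cross_degree_def sum_distrib_left)
  finally show ?thesis .
qed

lemma sum_degrees_tiling:
  assumes U: "finite U" and T: "T \<in> tilings E l U"
  shows "(\<Sum>u\<in>U. real (card (nbrs E U u))) = (\<Sum>s\<in>T. incidences E s s) + cross_degree E T"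
proof -
  note fin = tilings_finite[OF assms]
  have UT: "U = (\<Union>t\<in>T. set t)" and dis: "disjoint_family_on set T"
    using T by (auto simp: tilings_def)
  have deg: "card (nbrs E U u) = (\<Sum>t\<in>T. card (nbrs E (set t) u))" for u
  proof -
    have "nbrs E U u = (\<Union>t\<in>T. nbrs E (set t) u)" by (auto simp: UT)
    then show ?thesis using fin dis
      by (simp, intro card_UN_disjoint) (auto simp: disjoint_family_on_def)
  qed
  have "(\<Sum>u\<in>U. real (card (nbrs E U u))) = (\<Sum>s\<in>T. \<Sum>u\<in>set s. real (card (nbrs E U u)))"
    unfolding UT using fin dis
    by (subst sum.UNION_disjoint) (auto simp: disjoint_family_on_def)
  also have "\<dots> = (\<Sum>s\<in>T. \<Sum>t\<in>T. incidences E s t)"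
    unfolding incidences_def by (simp add: deg, rule sum.cong[OF refl], rule sum.swap)
  also have "\<dots> = (\<Sum>s\<in>T. incidences E s s + (\<Sum>t\<in>T - {s}. incidences E s t))"
    using fin by (intro sum.cong refl sum.remove) auto
  also have "\<dots> = (\<Sum>s\<in>T. incidences E s s) + cross_degree E T"
    by (simp only: sum.distrib cross_degree_def)
  finally show ?thesis .
qed

text \<open>A vertex has at most \<open>l\<close> neighbours in its own tuple. Only the remaining, cross edges get rarer in a
predictable way as tuples are removed, so the two kinds are kept apart.\<close>

lemma sum_degrees_tiling_le:
  assumes U: "finite U" and T: "T \<in> tilings E l U"
  shows "(\<Sum>u\<in>U. real (card (nbrs E U u))) \<le> real l * real (card U) + cross_degree E T"
proof -
  have self: "incidences E s s \<le> real l * real l" if "s \<in> T" for s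
  proof -
    have ls: "card (set s) = l"
      using that T by (auto simp: tilings_def ham_tuples_def distinct_card)
    have "incidences E s s \<le> (\<Sum>u\<in>set s. real l)"
      unfolding incidences_def ls[symmetric] by (intro sum_mono of_nat_mono card_mono) auto
    then show ?thesis using ls by simp
  qed
  have "(\<Sum>s\<in>T. incidences E s s) \<le> (\<Sum>s\<in>T. real l * real l)"
    by (intro sum_mono self)
  then show ?thesis
    using sum_degrees_tiling[OF assms] card_tiling[OF assms] by (simp add: mult_ac)
qed

lemma sum_degrees_le:
  assumes U: "finite U" and E: "finite E" "\<And>e. e \<in> E \<Longrightarrow> card e = 2"
  shows "(\<Sum>u\<in>U. card (nbrs E U u)) \<le> 2 * card E"
proof -
  have "(\<Sum>u\<in>U. card (nbrs E U u)) \<le> (\<Sum>u\<in>U. card {e \<in> E. u \<in> e})"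
  proof (rule sum_mono)
    fix u assume "u \<in> U"
    have "inj_on (\<lambda>w. {u, w}) (nbrs E U u)" by (auto simp: inj_on_def doubleton_eq_iff)
    then show "card (nbrs E U u) \<le> card {e \<in> E. u \<in> e}"
      by (rule card_inj_on_le) (use E in auto)
  qed
  also have "\<dots> = (\<Sum>e\<in>E. card {u \<in> U. u \<in> e})"
    unfolding card_eq_sum using U E(1) by (rule sum.swap_restrict)
  also have "\<dots> \<le> (\<Sum>e\<in>E. 2)"
  proof (rule sum_mono)
    fix e assume "e \<in> E"
    with E have "card e = 2" by blast
    then have "finite e" using card.infinite by fastforce
    then have "card {u \<in> U. u \<in> e} \<le> card e" by (intro card_mono) auto
    with \<open>card e = 2\<close> show "card {u \<in> U. u \<in> e} \<le> 2" by simp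
  qed
  finally show ?thesis by simp
qed

lemma cross_degree_le:
  assumes "finite U" "T \<in> tilings E l U" "finite E" "\<And>e. e \<in> E \<Longrightarrow> card e = 2"
  shows "cross_degree E T \<le> 2 * real (card E)"
proof -
  have "0 \<le> (\<Sum>s\<in>T. incidences E s s)" by (intro sum_nonneg) (simp add: incidences_def sum_nonneg)
  with sum_degrees_tiling[OF assms(1,2)]
  have "cross_degree E T \<le> real (\<Sum>u\<in>U. card (nbrs E U u))" by simp
  also have "\<dots> \<le> real (2 * card E)" using sum_degrees_le[OF assms(1,3,4)] by (simp only: of_nat_le_iff)
  finally show ?thesis by simp
qed

section \<open>An entropy bound for the number of tilings\<close>

text \<open>The logarithm of the bound on the number of tilings by \<open>k\<close> tuples. The \<open>j\<close>-th term contains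
\<open>l + j a\<close>, which bounds the number of uncovered neighbours that a vertex has on average when \<open>j\<close> other tuples are still
uncovered and \<open>a\<close> is the average number of neighbours that a vertex has in another tuple.\<close>

definition log_bound :: "nat \<Rightarrow> nat \<Rightarrow> real \<Rightarrow> real" where
  "log_bound l k a = real k * ln (real l) + real (l - 1) * (\<Sum>j<k. ln (real l + real j * a))"

text \<open>The average number of neighbours of a vertex in another tuple of \<open>T\<close>: there are \<open>l * card T\<close> vertices
and \<open>card T - 1\<close> other tuples for each. For a single tuple the division by zero makes it \<open>0\<close>,
as it should be.\<close>

definition slope :: "'b set set \<Rightarrow> nat \<Rightarrow> 'b list set \<Rightarrow> real" where
  "slope E l T = cross_degree E T / (real l * real (card T) * (real (card T) - 1))"

lemma slope_nonneg: "finite T \<Longrightarrow> slope E l T \<ge> 0"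
  by (cases "card T") (simp_all add: slope_def cross_degree_nonneg)

text \<open>Up to the factor \<open>1 / k\<close>, where \<open>card U = l * k\<close>, this is the probability that \<open>t\<close> is the tuple
produced by the following random process: choose a vertex of \<open>U\<close> uniformly (probability
\<open>1 / (l * k)\<close>), choose uniformly the position \<open>i\<close> that it has in the tuple (probability \<open>1 / l\<close>), and
from there choose the next \<open>l - 1\<close> entries in cyclic order, each uniformly among the neighbours of
the one before.\<close>

definition step_weight :: "'b set set \<Rightarrow> nat \<Rightarrow> 'b set \<Rightarrow> 'b list \<Rightarrow> real" where
  "step_weight E l U t =
     (\<Sum>i<l. \<Prod>j<l - 1. 1 / real (card (nbrs E U (t ! ((i + j) mod l))))) / (real l)\<^sup>2"

lemma step_weight_nonneg: "step_weight E l U t \<ge> 0"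
  by (auto simp: step_weight_def intro!: sum_nonneg prod_nonneg divide_nonneg_nonneg)

lemma degree_pos:
  assumes "finite U" "t \<in> ham_tuples E l U" "u \<in> set t"
  shows "card (nbrs E U u) > 0"
proof -
  obtain i where i: "i < l" "u = t ! i"
    using assms by (auto simp: ham_tuples_def in_set_conv_nth)
  have "Suc i mod l < length t" using i assms(2) by (auto simp: ham_tuples_def)
  then have "t ! (Suc i mod l) \<in> set t" by (rule nth_mem)
  then have "t ! (Suc i mod l) \<in> U" using assms(2) unfolding ham_tuples_def by blast
  then have "t ! (Suc i mod l) \<in> nbrs E U u"
    using i assms(2) by (simp add: ham_tuples_def)
  then show ?thesis using assms(1) by (auto simp: card_gt_0_iff)
qed

text \<open>Jensen's inequality for the average over the starting position \<open>i\<close>; by \<open>sum_rotations\<close> each vertex of the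
tuple contributes to the average with the same weight \<open>(l - 1) / l\<close>.\<close>

lemma step_weight_ge:
  assumes U: "finite U" and l: "0 < l" and t: "t \<in> ham_tuples E l U"
  shows "exp (- ln (real l) - real (l - 1) / real l * (\<Sum>u\<in>set t. ln (real (card (nbrs E U u)))))
    \<le> step_weight E l U t"
proof -
  let ?D = "\<lambda>u. real (card (nbrs E U u))"
  let ?v = "\<lambda>i j. t ! ((i + j) mod l)"
  have pos: "?D (?v i j) > 0" for i j
    using degree_pos[OF U t] t l by (simp add: ham_tuples_def)
  have tl: "length t = l" "distinct t" using t by (auto simp: ham_tuples_def)
  have "(\<Sum>i<l. - (\<Sum>j<l - 1. ln (?D (?v i j)))) = - (real (l - 1) * (\<Sum>u\<in>set t. ln (?D u)))"
    unfolding sum_negf using sum_rotations[OF tl, of "\<lambda>u. ln (?D u)" "l - 1"] by (simp only:)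
  then have "- ln (real l) - real (l - 1) / real l * (\<Sum>u\<in>set t. ln (?D u))
      = (\<Sum>i<l. - (\<Sum>j<l - 1. ln (?D (?v i j)))) / real (card {..<l}) - ln (real l)"
    by (simp only: card_lessThan) simp
  then have "exp (- ln (real l) - real (l - 1) / real l * (\<Sum>u\<in>set t. ln (?D u)))
      = exp ((\<Sum>i<l. - (\<Sum>j<l - 1. ln (?D (?v i j)))) / real (card {..<l})) / real l"
    using l by (simp only: exp_diff exp_ln of_nat_0_less_iff)
  also have "\<dots> \<le> (\<Sum>i<l. exp (- (\<Sum>j<l - 1. ln (?D (?v i j))))) / real (card {..<l}) / real l"
    using l by (intro divide_right_mono exp_mean_le_mean_exp) auto
  also have "(\<Sum>i<l. exp (- (\<Sum>j<l - 1. ln (?D (?v i j))))) = (\<Sum>i<l. \<Prod>j<l - 1. 1 / ?D (?v i j))"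
  proof (rule sum.cong[OF refl])
    fix i
    have "exp (- (\<Sum>j<l - 1. ln (?D (?v i j)))) = (\<Prod>j<l - 1. exp (- ln (?D (?v i j))))"
      unfolding sum_negf[symmetric] by (rule exp_sum) simp
    also have "\<dots> = (\<Prod>j<l - 1. 1 / ?D (?v i j))"
      using pos by (intro prod.cong refl) (simp add: exp_minus divide_inverse)
    finally show "exp (- (\<Sum>j<l - 1. ln (?D (?v i j)))) = (\<Prod>j<l - 1. 1 / ?D (?v i j))" .
  qed
  finally show ?thesis by (simp add: step_weight_def power2_eq_square)
qed

lemma sum_step_weight_le:
  assumes "finite U" "0 < l"
  shows "(\<Sum>t\<in>ham_tuples E l U. step_weight E l U t) \<le> real (card U) / real l"
proof -
  have "(\<Sum>t\<in>ham_tuples E l U. step_weight E l U t)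
      = (\<Sum>i<l. \<Sum>t\<in>ham_tuples E l U. \<Prod>j<l - 1. 1 / real (card (nbrs E U (t ! ((i + j) mod l))))) / (real l)\<^sup>2"
    unfolding step_weight_def sum_divide_distrib[symmetric] by (subst sum.swap) (rule refl)
  also have "\<dots> \<le> (\<Sum>i<l. real (card U)) / (real l)\<^sup>2"
    by (intro divide_right_mono sum_mono sum_ham_tuples_le assms) simp
  finally show ?thesis using assms by (simp add: power2_eq_square)
qed

text \<open>Removing a random tuple does not change the expected slope. For \<open>card T = 2\<close> the slope after the
removal is \<open>0\<close> by convention, but then only \<open>j = 0\<close> is in range.\<close>

lemma sum_slope_remove:
  assumes T: "finite T" and j: "j < card T - 1"
  shows "real j * ((\<Sum>t\<in>T. slope E l (T - {t})) / real (card T)) = real j * slope E l T"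
proof (cases "card T = 2")
  case True
  with j show ?thesis by simp
next
  case False
  define k where "k = real (card T)"
  have k: "k > 2" using False j by (simp add: k_def)
  have "(\<Sum>t\<in>T. slope E l (T - {t})) = (\<Sum>t\<in>T. cross_degree E (T - {t}) / (real l * (k - 1) * (k - 2)))"
  proof (rule sum.cong[OF refl])
    fix t assume "t \<in> T"
    then have "real (card (T - {t})) = k - 1"
      using T j by (simp add: k_def of_nat_diff)
    then show "slope E l (T - {t}) = cross_degree E (T - {t}) / (real l * (k - 1) * (k - 2))"
      by (simp add: slope_def)
  qed
  also have "\<dots> = (k - 2) * cross_degree E T / (real l * (k - 1) * (k - 2))"
    unfolding sum_divide_distrib[symmetric] sum_cross_degree_remove[OF T] k_def by simp
  finally have "(\<Sum>t\<in>T. slope E l (T - {t})) / k = slope E l T"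
    using k by (simp add: slope_def k_def[symmetric])
  then show ?thesis by (simp add: k_def)
qed

text \<open>Two applications of Jensen's inequality for \<open>ln\<close>. Over the vertices of \<open>U\<close>, the average degree is at
most \<open>l + (k - 1) * slope\<close>, which produces the top term \<open>j = k - 1\<close> of \<open>log_bound\<close>. Over the tuple that
is removed, the expected slope stays the same, so the terms \<open>j < k - 1\<close> reproduce themselves.\<close>

lemma log_bound_recursion:
  assumes U: "finite U" and l: "0 < l" and T: "T \<in> tilings E l U" and ne: "T \<noteq> {}"
  shows "(\<Sum>t\<in>T. ln (real l) + real (l - 1) / real l * (\<Sum>u\<in>set t. ln (real (card (nbrs E U u)))))
     + (\<Sum>t\<in>T. log_bound l (card T - 1) (slope E l (T - {t})))
     \<le> real (card T) * log_bound l (card T) (slope E l T)"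
proof -
  let ?D = "\<lambda>u. real (card (nbrs E U u))"
  define k where "k = card T"
  note fin = tilings_finite[OF U T]
  have k: "k > 0" using fin ne by (simp add: k_def card_gt_0_iff)
  have cU: "card U = l * k" using card_tiling[OF U T] by (simp add: k_def)
  have Une: "U \<noteq> {}" using cU k l by auto
  have UT: "U = (\<Union>t\<in>T. set t)" and dis: "disjoint_family_on set T" and ham: "T \<subseteq> ham_tuples E l U"
    using T by (auto simp: tilings_def)
  have Dpos: "?D u > 0" if "u \<in> U" for u
    using that degree_pos[OF U] ham UT by fastforce
  have "(\<Sum>t\<in>T. \<Sum>u\<in>set t. ln (?D u)) = (\<Sum>u\<in>(\<Union>t\<in>T. set t). ln (?D u))"
    using fin dis by (subst sum.UNION_disjoint) (auto simp: disjoint_family_on_def)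
  also have "\<dots> = (\<Sum>u\<in>U. ln (?D u))" by (simp only: UT[symmetric])
  also have "\<dots> \<le> real (card U) * ln ((\<Sum>u\<in>U. ?D u) / real (card U))"
    by (rule sum_ln_le_ln_mean[OF U Une Dpos])
  also have "\<dots> \<le> real (card U) * ln (real l + real (k - 1) * slope E l T)"
  proof -
    have pos: "(\<Sum>u\<in>U. ?D u) / real (card U) > 0"
      using cU k l Dpos U Une by (intro divide_pos_pos sum_pos) auto
    have "(\<Sum>u\<in>U. ?D u) / real (card U) \<le> (real l * real (card U) + cross_degree E T) / real (card U)"
      by (intro divide_right_mono sum_degrees_tiling_le[OF U T]) simp
    also have "\<dots> = real l + cross_degree E T / (real l * real k)"
      using cU k l by (simp add: field_simps)
    also have "cross_degree E T / (real l * real k) = real (k - 1) * slope E l T"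
    proof (cases "k = 1")
      case True
      then obtain t where "T = {t}" using card_1_singletonE k_def by metis
      then show ?thesis using True by (simp add: cross_degree_def)
    next
      case False
      then have "real k - 1 \<noteq> 0" "real (k - 1) = real k - 1" using k by (auto simp: of_nat_diff)
      then show ?thesis by (simp add: slope_def k_def[symmetric])
    qed
    finally show ?thesis using pos by (intro mult_left_mono ln_mono) auto
  qed
  finally have 1: "(\<Sum>t\<in>T. \<Sum>u\<in>set t. ln (?D u)) \<le> real l * real k * ln (real l + real (k - 1) * slope E l T)"
    by (simp add: cU)
  have "(\<Sum>t\<in>T. ln (real l) + real (l - 1) / real l * (\<Sum>u\<in>set t. ln (?D u)))
      = real k * ln (real l) + real (l - 1) / real l * (\<Sum>t\<in>T. \<Sum>u\<in>set t. ln (?D u))"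
    by (simp only: sum.distrib sum_constant sum_distrib_left[symmetric] k_def)
  also have "\<dots> \<le> real k * ln (real l) + real (l - 1) / real l * (real l * real k * ln (real l + real (k - 1) * slope E l T))"
    using 1 by (intro add_left_mono mult_left_mono) auto
  also have "\<dots> = real k * (ln (real l) + real (l - 1) * ln (real l + real (k - 1) * slope E l T))"
    using l by (simp add: field_simps)
  finally have A: "(\<Sum>t\<in>T. ln (real l) + real (l - 1) / real l * (\<Sum>u\<in>set t. ln (?D u)))
     \<le> real k * (ln (real l) + real (l - 1) * ln (real l + real (k - 1) * slope E l T))" .
  have "(\<Sum>t\<in>T. log_bound l (k - 1) (slope E l (T - {t})))
     = real k * (real (k - 1) * ln (real l))
       + real (l - 1) * (\<Sum>j<k - 1. \<Sum>t\<in>T. ln (real l + real j * slope E l (T - {t})))"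
    unfolding log_bound_def sum.distrib sum_constant sum_distrib_left[symmetric] k_def[symmetric]
    by (subst sum.swap) simp
  also have "\<dots> \<le> real k * (real (k - 1) * ln (real l))
       + real (l - 1) * (\<Sum>j<k - 1. real k * ln (real l + real j * slope E l T))"
  proof (intro add_left_mono mult_left_mono sum_mono)
    fix j assume "j \<in> {..<k - 1}"
    then have j: "j < card T - 1" by (simp add: k_def)
    have "(\<Sum>t\<in>T. ln (real l + real j * slope E l (T - {t})))
        \<le> real (card T) * ln ((\<Sum>t\<in>T. real l + real j * slope E l (T - {t})) / real (card T))"
      using fin ne l by (intro sum_ln_le_ln_mean add_pos_nonneg mult_nonneg_nonneg slope_nonneg) auto
    also have "(\<Sum>t\<in>T. real l + real j * slope E l (T - {t})) / real (card T)
        = real l + real j * ((\<Sum>t\<in>T. slope E l (T - {t})) / real (card T))"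
      using k unfolding k_def by (simp add: sum.distrib sum_distrib_left[symmetric] add_divide_distrib)
    also have "\<dots> = real l + real j * slope E l T"
      by (simp only: sum_slope_remove[OF fin j])
    finally show "(\<Sum>t\<in>T. ln (real l + real j * slope E l (T - {t}))) \<le> real k * ln (real l + real j * slope E l T)"
      by (simp add: k_def)
  qed simp
  finally have B: "(\<Sum>t\<in>T. log_bound l (k - 1) (slope E l (T - {t})))
    \<le> real k * (real (k - 1) * ln (real l) + real (l - 1) * (\<Sum>j<k - 1. ln (real l + real j * slope E l T)))"
    by (simp add: sum_distrib_left[symmetric] algebra_simps)
  have "log_bound l k (slope E l T)
     = (ln (real l) + real (l - 1) * ln (real l + real (k - 1) * slope E l T))
       + (real (k - 1) * ln (real l) + real (l - 1) * (\<Sum>j<k - 1. ln (real l + real j * slope E l T)))"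
    using k by (cases k) (simp_all add: log_bound_def algebra_simps)
  with A B show ?thesis unfolding k_def[symmetric] by (simp only: distrib_left add_mono)
qed

text \<open>The right-hand side is the average over the tuple \<open>t\<close> of \<open>T\<close> that the random process produces
first. By Jensen's inequality for \<open>exp\<close> it is enough to compare exponents, which is
\<open>log_bound_recursion\<close>.\<close>

lemma tiling_weight_step:
  assumes U: "finite U" and l: "0 < l" and T: "T \<in> tilings E l U" and ne: "T \<noteq> {}"
  shows "exp (- log_bound l (card T) (slope E l T))
    \<le> (\<Sum>t\<in>T. step_weight E l U t * exp (- log_bound l (card T - 1) (slope E l (T - {t})))) / real (card T)"
proof -
  let ?y = "\<lambda>t. ln (real l) + real (l - 1) / real l * (\<Sum>u\<in>set t. ln (real (card (nbrs E U u))))"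
  let ?b = "\<lambda>t. log_bound l (card T - 1) (slope E l (T - {t}))"
  note fin = tilings_finite[OF U T]
  have k: "real (card T) > 0" using fin ne by (simp add: card_gt_0_iff)
  have "- log_bound l (card T) (slope E l T) \<le> (\<Sum>t\<in>T. - ?y t - ?b t) / real (card T)"
    using log_bound_recursion[OF assms] k
    by (simp add: sum_subtractf sum_negf sum.distrib field_simps del: of_nat_diff)
  then have "exp (- log_bound l (card T) (slope E l T)) \<le> exp ((\<Sum>t\<in>T. - ?y t - ?b t) / real (card T))"
    by simp
  also have "\<dots> \<le> (\<Sum>t\<in>T. exp (- ?y t - ?b t)) / real (card T)"
    using fin ne by (rule exp_mean_le_mean_exp)
  also have "\<dots> \<le> (\<Sum>t\<in>T. step_weight E l U t * exp (- ?b t)) / real (card T)"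
  proof (intro divide_right_mono sum_mono)
    fix t assume "t \<in> T"
    then have "t \<in> ham_tuples E l U" using T by (auto simp: tilings_def)
    from step_weight_ge[OF U l this]
    have "exp (- ?y t) * exp (- ?b t) \<le> step_weight E l U t * exp (- ?b t)"
      by (intro mult_right_mono) auto
    then show "exp (- ?y t - ?b t) \<le> step_weight E l U t * exp (- ?b t)"
      by (simp only: exp_add[symmetric] diff_conv_add_uminus)
  qed simp
  finally show ?thesis .
qed

text \<open>The weights are lower bounds for the probabilities with which the random process, repeated on the
uncovered vertices, produces the tilings; hence they sum to at most one. The induction removes the
first tuple: a tiling \<open>T\<close> with a chosen \<open>t \<in> T\<close> is the same as \<open>t\<close> with a tiling of \<open>U - set t\<close>.\<close>

lemma sum_tiling_weights_le_1:
  assumes "finite U" "0 < l"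
  shows "(\<Sum>T\<in>tilings E l U. exp (- log_bound l (card T) (slope E l T))) \<le> 1"
  using assms(1)
proof (induction U rule: finite_psubset_induct)
  case (psubset U)
  note U = \<open>finite U\<close>
  let ?W = "\<lambda>T. exp (- log_bound l (card T) (slope E l T))"
  let ?H = "ham_tuples E l U" and ?Ts = "tilings E l U"
  show ?case
  proof (cases "U = {}")
    case True
    have "?Ts \<subseteq> {{}}" using assms(2) by (auto simp: True tilings_def ham_tuples_def)
    then have "(\<Sum>T\<in>?Ts. ?W T) \<le> (\<Sum>T\<in>{{}}. ?W T)" by (intro sum_mono2) auto
    then show ?thesis by (simp add: log_bound_def)
  next
    case False
    define k where "k = card U div l"
    have ck: "card T = k" "k > 0" "T \<noteq> {}" if "T \<in> ?Ts" for T
    proof -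
      have "card U = l * card T" by (rule card_tiling[OF U that])
      then show "card T = k" "k > 0" "T \<noteq> {}"
        using assms(2) U False by (auto simp: k_def)
    qed
    have cU: "real (card U) / real l \<le> k" if "T \<in> ?Ts" for T
      using card_tiling[OF U that] ck[OF that] assms(2) by simp
    show ?thesis
    proof (cases "?Ts = {}")
      case ne: False
      then have k: "k > 0" using ck by blast
      have "(\<Sum>T\<in>?Ts. ?W T) \<le> (\<Sum>T\<in>?Ts. (\<Sum>t\<in>T. step_weight E l U t * ?W (T - {t})) / real k)"
      proof (rule sum_mono)
        fix T assume T: "T \<in> ?Ts"
        have "card (T - {t}) = card T - 1" if "t \<in> T" for t
          using that tilings_finite[OF U T] by simp
        then show "?W T \<le> (\<Sum>t\<in>T. step_weight E l U t * ?W (T - {t})) / real k"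
          using tiling_weight_step[OF U assms(2) T ck(3)[OF T]] ck(1)[OF T] by simp
      qed
      also have "\<dots> = (\<Sum>T\<in>?Ts. \<Sum>t\<in>T. step_weight E l U t * ?W (T - {t})) / real k"
        by (simp only: sum_divide_distrib)
      also have "(\<Sum>T\<in>?Ts. \<Sum>t\<in>T. step_weight E l U t * ?W (T - {t}))
          = (\<Sum>T\<in>?Ts. \<Sum>t | t \<in> ?H \<and> t \<in> T. step_weight E l U t * ?W (T - {t}))"
        by (intro sum.cong refl) (auto simp: tilings_def)
      also have "\<dots> = (\<Sum>t\<in>?H. \<Sum>T | T \<in> ?Ts \<and> t \<in> T. step_weight E l U t * ?W (T - {t}))"
        using U by (intro sum.swap_restrict finite_tilings finite_ham_tuples)
      also have "\<dots> \<le> (\<Sum>t\<in>?H. step_weight E l U t)"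
      proof (rule sum_mono)
        fix t assume t: "t \<in> ?H"
        have inj: "inj_on (\<lambda>T. T - {t}) {T \<in> ?Ts. t \<in> T}" by (auto simp: inj_on_def)
        have "(\<Sum>T | T \<in> ?Ts \<and> t \<in> T. ?W (T - {t})) = (\<Sum>T\<in>(\<lambda>T. T - {t}) ` {T \<in> ?Ts. t \<in> T}. ?W T)"
          by (simp add: sum.reindex[OF inj] o_def)
        also have "\<dots> \<le> (\<Sum>T\<in>tilings E l (U - set t). ?W T)"
          using U tiling_remove by (intro sum_mono2 finite_tilings) (auto simp del: log_bound_def)
        also have "\<dots> \<le> 1"
        proof (rule psubset.IH)
          have "t \<noteq> []" "set t \<subseteq> U" using t assms(2) by (auto simp: ham_tuples_def)
          then show "U - set t \<subset> U" by (cases t) auto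
        qed
        finally have "step_weight E l U t * (\<Sum>T | T \<in> ?Ts \<and> t \<in> T. ?W (T - {t})) \<le> step_weight E l U t * 1"
          by (rule mult_left_mono) (rule step_weight_nonneg)
        then show "(\<Sum>T | T \<in> ?Ts \<and> t \<in> T. step_weight E l U t * ?W (T - {t})) \<le> step_weight E l U t"
          by (simp only: sum_distrib_left mult_1_right)
      qed
      also have "\<dots> \<le> real (card U) / real l" by (rule sum_step_weight_le[OF U assms(2)])
      also have "\<dots> \<le> real k" using ne cU by blast
      finally show ?thesis using k by (simp add: divide_right_mono)
    qed simp
  qed
qed

text \<open>The slope of every tiling is at most the density \<open>2 m / (l K (K - 1))\<close>, so each of the weights,
which sum to at most one, is at least the exponential of minus the bound.\<close>

lemma card_tilings_le:
  assumes U: "finite U" and l: "0 < l" and K: "card U = l * K"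
    and E: "finite E" "\<And>e. e \<in> E \<Longrightarrow> card e = 2"
  shows "real (card (tilings E l U)) \<le> real l ^ K *
     (\<Prod>j<K. real l + real j * (2 * real (card E) / (real l * real K * (real K - 1)))) ^ (l - 1)"
proof -
  define a where "a = 2 * real (card E) / (real l * real K * (real K - 1))"
  have "real K * (real K - 1) \<ge> 0" by (cases K) auto
  then have lK: "real l * real K * (real K - 1) \<ge> 0" by (simp add: mult.assoc)
  then have a: "a \<ge> 0" by (simp add: a_def)
  have pos: "real l + real j * b > 0" if "b \<ge> 0" for j b using l that by (simp add: add_pos_nonneg)
  have "exp (- log_bound l K a) \<le> exp (- log_bound l (card T) (slope E l T))" if T: "T \<in> tilings E l U" for T
  proof -
    have cT: "card T = K" using card_tiling[OF U T] K l by simp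
    have "slope E l T \<le> a"
      unfolding slope_def a_def cT using cross_degree_le[OF U T E] lK by (rule divide_right_mono)
    then have "ln (real l + real j * slope E l T) \<le> ln (real l + real j * a)" for j
      using a pos[OF slope_nonneg[OF tilings_finite[OF U T]]]
      by (intro ln_mono add_left_mono mult_left_mono) auto
    then have "log_bound l K (slope E l T) \<le> log_bound l K a"
      unfolding log_bound_def by (intro add_left_mono mult_left_mono sum_mono) auto
    then show ?thesis by (simp add: cT)
  qed
  then have "(\<Sum>T\<in>tilings E l U. exp (- log_bound l K a)) \<le> 1"
    using sum_tiling_weights_le_1[OF U l, of E] by (meson order_trans sum_mono)
  then have "real (card (tilings E l U)) \<le> exp (log_bound l K a)"
    by (simp add: exp_minus field_simps)
  also have "\<dots> = real l ^ K * (\<Prod>j<K. real l + real j * a) ^ (l - 1)"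
    using l pos[OF a]
    by (simp add: log_bound_def exp_add exp_of_nat_mult exp_sum del: of_nat_diff)
  finally show ?thesis by (simp add: a_def)
qed

section \<open>Riemann sums of the logarithm and factorials\<close>

text \<open>The function \<open>x ln x - x\<close> is convex with derivative \<open>ln x\<close>.\<close>

lemma scaled_ln_le_diff:
  fixes x h :: real
  assumes "x > 0" "h > 0"
  shows "h * ln x \<le> ((x + h) * ln (x + h) - (x + h)) - (x * ln x - x)"
proof -
  have "ln (x / (x + h)) \<le> x / (x + h) - 1"
    using assms by (intro ln_le_minus_one) auto
  also have "x / (x + h) - 1 = - (h / (x + h))" using assms by (simp add: field_simps)
  finally have "h / (x + h) \<le> ln (x + h) - ln x" using assms by (simp add: ln_div)
  then have "(x + h) * (h / (x + h)) \<le> (x + h) * (ln (x + h) - ln x)"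
    using assms by (intro mult_left_mono) auto
  then have "h \<le> (x + h) * (ln (x + h) - ln x)" using assms by simp
  then show ?thesis by (simp add: algebra_simps)
qed

text \<open>Comparison of the sum with the integral of \<open>ln\<close> from \<open>y\<close> to \<open>1 + y\<close>, written as a telescoping
sum of differences of the antiderivative. The term \<open>- 1\<close> is the source of Euler's number in the bound.\<close>

lemma sum_ln_equidistant_le:
  assumes "K > 0" "y > 0"
  shows "(\<Sum>j<K. ln (y + real j / real K)) \<le> real K * ((1 + y) * ln (1 + y) - y * ln y - 1)"
proof -
  define f where "f = (\<lambda>j. let x = y + real j / real K in x * ln x - x)"
  have "(\<Sum>j<K. (1 / real K) * ln (y + real j / real K)) \<le> (\<Sum>j<K. f (Suc j) - f j)"
  proof (rule sum_mono)
    fix j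
    have "(1 / real K) * ln (y + real j / real K) \<le>
       (let x = (y + real j / real K) + 1 / real K in x * ln x - x) - f j"
      unfolding Let_def f_def using assms by (intro scaled_ln_le_diff add_pos_nonneg) auto
    also have "(y + real j / real K) + 1 / real K = y + real (Suc j) / real K"
      by (simp add: add_divide_distrib)
    finally show "(1 / real K) * ln (y + real j / real K) \<le> f (Suc j) - f j" by (simp only: f_def)
  qed
  also have "\<dots> = f K - f 0" by (rule sum_lessThan_telescope)
  also have "\<dots> = (1 + y) * ln (1 + y) - y * ln y - 1"
    using assms by (simp add: f_def Let_def add.commute)
  finally have "real K * (\<Sum>j<K. (1 / real K) * ln (y + real j / real K)) \<le> 
      real K * ((1 + y) * ln (1 + y) - y * ln y - 1)" by (rule mult_left_mono) simp
  then show ?thesis using assms by (simp add: sum_divide_distrib[symmetric])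
qed

lemma entropy_term_small:
  assumes "\<epsilon> > (0::real)"
  obtains y0 :: real where "y0 > 0" "\<And>y. 0 < y \<Longrightarrow> y < y0 \<Longrightarrow> (1 + y) * ln (1 + y) - y * ln y \<le> ln (1 + \<epsilon>)"
proof -
  have "((\<lambda>y::real. (1 + y) * ln (1 + y) - y * ln y) \<longlongrightarrow> 0) (at_right 0)" by real_asymp
  moreover have "0 < ln (1 + \<epsilon>)" using assms by simp
  ultimately have "\<forall>\<^sub>F y in at_right 0. (1 + y) * ln (1 + y) - y * ln y < ln (1 + \<epsilon>)"
    by (rule order_tendstoD)
  then obtain y0 where "y0 > 0" "\<And>y. 0 < y \<Longrightarrow> y < y0 \<Longrightarrow> (1 + y) * ln (1 + y) - y * ln y < ln (1 + \<epsilon>)"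
    by (auto simp: eventually_at_right_field)
  then show ?thesis using that by (meson less_imp_le)
qed

text \<open>Each factor is at most \<open>d * (y + j / K)\<close>: the summand \<open>1 / K\<close> of \<open>y\<close> absorbs the passage from
\<open>K - 1\<close> to \<open>K\<close> in the denominator.\<close>

lemma prod_arithmetic_le:
  fixes d y c :: real
  assumes "K > 0" "d > 0" "c > 0" and y: "y = real l / d + 1 / real K"
    and small: "(1 + y) * ln (1 + y) - y * ln y \<le> ln c"
  shows "(\<Prod>j<K. real l + real j * (d / (real K - 1))) \<le> (c * (d / exp 1)) ^ K"
proof -
  have y0: "y > 0" using assms by (simp add: add_nonneg_pos)
  have pos: "y + real j / real K > 0" for j using y0 by (simp add: add_pos_nonneg)
  have "(\<Prod>j<K. real l + real j * (d / (real K - 1))) \<le> (\<Prod>j<K. d * (y + real j / real K))"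
  proof (rule prod_mono)
    fix j assume "j \<in> {..<K}"
    then have j: "real j + 1 \<le> real K" by simp
    have "real j / (real K - 1) \<le> (real j + 1) / real K"
    proof (cases "K = 1")
      case False
      then have "real K > 1" using assms by linarith
      then show ?thesis using j by (simp add: divide_simps algebra_simps)
    qed simp
    then have "d * (real j / (real K - 1)) \<le> d * ((real j + 1) / real K)"
      using assms by (intro mult_left_mono) auto
    moreover have "d * (y + real j / real K) = real l + d * ((real j + 1) / real K)"
      using assms by (simp add: y distrib_left add_divide_distrib)
    moreover have "0 \<le> d / (real K - 1)" using assms by (cases K) auto
    then have "0 \<le> real l + real j * (d / (real K - 1))" by (intro add_nonneg_nonneg mult_nonneg_nonneg) auto
    ultimately show "0 \<le> real l + real j * (d / (real K - 1)) \<and>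
        real l + real j * (d / (real K - 1)) \<le> d * (y + real j / real K)"
      by (simp add: mult.commute)
  qed
  also have "\<dots> = d ^ K * exp (\<Sum>j<K. ln (y + real j / real K))"
    using pos by (simp add: prod.distrib exp_sum)
  also have "\<dots> \<le> d ^ K * exp (real K * (ln c - 1))"
  proof (intro mult_left_mono)
    have "real K * ((1 + y) * ln (1 + y) - y * ln y - 1) \<le> real K * (ln c - 1)"
      using small by (intro mult_left_mono) auto
    with sum_ln_equidistant_le[OF assms(1) y0]
    show "exp (\<Sum>j<K. ln (y + real j / real K)) \<le> exp (real K * (ln c - 1))" by simp
  qed (use assms in auto)
  also have "exp (real K * (ln c - 1)) = (c / exp 1) ^ K"
    using assms by (simp add: exp_of_nat_mult exp_diff)
  finally show ?thesis by (simp add: power_mult_distrib[symmetric] mult.commute)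
qed

text \<open>Together with \<open>fact_le_power\<close> a weak form of Stirling's formula, which is enough up to subexponential factors.\<close>

lemma power_le_fact: "(real n / exp 1) ^ n \<le> fact n"
proof (induction n)
  case (Suc n)
  have "(real (Suc n) / exp 1) ^ Suc n \<le> real (Suc n) * (real n / exp 1) ^ n"
  proof (cases "n = 0")
    case False
    have "(1 + 1 / real n) ^ n \<le> exp (1 / real n) ^ n"
      using exp_ge_add_one_self[of "1 / real n"] by (intro power_mono) auto
    also have "\<dots> = exp 1" using False by (simp add: exp_of_nat_mult[symmetric])
    finally have "(real (Suc n) / real n) ^ n \<le> exp 1" using False by (simp add: field_simps)
    then have "real (Suc n) ^ n \<le> exp 1 * real n ^ n" using False by (simp add: power_divide divide_simps)
    then have "real (Suc n) * real (Suc n) ^ n \<le> real (Suc n) * (exp 1 * real n ^ n)"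
      by (intro mult_left_mono) auto
    then show ?thesis by (simp add: power_divide field_simps del: of_nat_Suc)
  qed (simp add: divide_le_eq)
  also have "\<dots> \<le> real (Suc n) * fact n" using Suc.IH by (intro mult_left_mono) auto
  finally show ?case by simp
qed simp

lemma fact_le_power:
  assumes "n > 0"
  shows "fact n \<le> exp 1 * real n * (real n / exp 1) ^ n"
  using assms
proof (induction n rule: nat_induct_non_zero)
  case 1
  show ?case by simp
next
  case (Suc n)
  have "real n / real (Suc n) = 1 - 1 / real (Suc n)" by (simp add: field_simps)
  also have "\<dots> \<le> exp (- (1 / real (Suc n)))"
    using exp_ge_add_one_self[of "- (1 / real (Suc n))"] by simp
  finally have "(real n / real (Suc n)) ^ Suc n \<le> exp (- (1 / real (Suc n))) ^ Suc n"
    by (intro power_mono) auto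
  also have "\<dots> = exp (- 1)" by (subst exp_of_nat_mult[symmetric]) simp
  finally have "exp 1 * real n ^ Suc n \<le> real (Suc n) ^ Suc n"
    by (simp add: power_divide exp_minus divide_simps mult.commute del: power_Suc of_nat_Suc)
  then have key: "exp 1 * real n * (real n / exp 1) ^ n \<le> exp 1 * (real (Suc n) / exp 1) ^ Suc n"
    by (simp add: power_divide field_simps del: of_nat_Suc)
  have "fact (Suc n) = real (Suc n) * fact n" by simp
  also have "\<dots> \<le> real (Suc n) * (exp 1 * real n * (real n / exp 1) ^ n)"
    using Suc.IH by (intro mult_left_mono) auto
  also have "\<dots> \<le> real (Suc n) * (exp 1 * (real (Suc n) / exp 1) ^ Suc n)"
    using key by (intro mult_left_mono) auto
  finally show ?case by (simp only: mult_ac)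
qed

section \<open>Factors as tilings\<close>

lemma hamiltonian_labelling:
  assumes "hamiltonian F"
  obtains \<phi> where "bij_betw \<phi> {..<card (verts F)} (verts F)"
    "\<And>i. i < card (verts F) \<Longrightarrow> {\<phi> i, \<phi> (Suc i mod card (verts F))} \<in> edges F"
proof -
  let ?l = "card (verts F)"
  obtain H where "spanning_subgraph H F" "isomorphic (cycle_graph ?l) H"
    using assms by (auto simp: hamiltonian_def)
  then obtain \<phi> where \<phi>: "bij_betw \<phi> {..<?l} (verts H)"
      "edges H = (\<lambda>e. \<phi> ` e) ` {{i, Suc i mod ?l} | i. i < ?l}"
    and H: "verts H = verts F" "edges H \<subseteq> edges F"
    by (auto simp: isomorphic_def spanning_subgraph_def cycle_graph_def)
  have "{\<phi> i, \<phi> (Suc i mod ?l)} \<in> edges F" if "i < ?l" for i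
  proof -
    have "\<phi> ` {i, Suc i mod ?l} \<in> edges H" unfolding \<phi>(2) using that by blast
    with H(2) show ?thesis by auto
  qed
  with \<phi>(1) H(1) show ?thesis using that by auto
qed

text \<open>A graph with the labelling \<open>\<phi>\<close> of its vertices along a Hamilton cycle. It turns a copy of \<open>F\<close> into a
tuple of vertices that belongs to \<open>ham_tuples\<close>.\<close>

locale labelled_ham_graph =
  fixes F :: "'a sgraph" and l :: nat and \<phi> :: "nat \<Rightarrow> 'a"
  assumes F: "simple_graph F" and l: "l = card (verts F)" "2 \<le> l"
    and \<phi>: "bij_betw \<phi> {..<l} (verts F)"
    and cyc: "\<And>i. i < l \<Longrightarrow> {\<phi> i, \<phi> (Suc i mod l)} \<in> edges F"
begin

lemma finite_F: "finite (verts F)" "finite (edges F)"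
  using F simple_graph_finite_edges[OF F] by (simp_all add: simple_graph_def)

lemma \<phi>_image: "\<phi> ` {..<l} = verts F"
  using \<phi> by (simp add: bij_betw_def)

text \<open>The copy of \<open>F\<close> in which \<open>t ! i\<close> plays the role of \<open>\<phi> i\<close>.\<close>

definition tuple_edges :: "'b list \<Rightarrow> 'b set set" where
  "tuple_edges t = {{t ! i, t ! j} | i j. i < l \<and> j < l \<and> {\<phi> i, \<phi> j} \<in> edges F}"

definition copy_tuples :: "'b sgraph \<Rightarrow> 'b list set" where
  "copy_tuples D = {map (\<lambda>i. f (\<phi> i)) [0..<l] | f.
     bij_betw f (verts F) (verts D) \<and> edges D = (\<lambda>e. f ` e) ` edges F}"

lemma copy_tuple:
  assumes "t \<in> copy_tuples D"
  shows "length t = l" "distinct t" "set t = verts D" "tuple_edges t = edges D"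
    "\<And>i. i < l \<Longrightarrow> {t ! i, t ! (Suc i mod l)} \<in> edges D"
proof -
  obtain f where t: "t = map (\<lambda>i. f (\<phi> i)) [0..<l]"
    and f: "bij_betw f (verts F) (verts D)" "edges D = (\<lambda>e. f ` e) ` edges F"
    using assms by (auto simp: copy_tuples_def)
  have f\<phi>: "bij_betw (\<lambda>i. f (\<phi> i)) {..<l} (verts D)"
    using bij_betw_trans[OF \<phi> f(1)] by (simp add: o_def)
  show len: "length t = l" by (simp add: t)
  show "distinct t" using f\<phi> by (simp add: t distinct_map bij_betw_def atLeast0LessThan)
  show "set t = verts D" using f\<phi> by (simp add: t bij_betw_def atLeast0LessThan)
  have nth: "t ! i = f (\<phi> i)" if "i < l" for i using that by (simp add: t)
  show "{t ! i, t ! (Suc i mod l)} \<in> edges D" if "i < l" for i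
  proof -
    have "f ` {\<phi> i, \<phi> (Suc i mod l)} \<in> edges D" unfolding f(2) using cyc[OF that] by blast
    moreover have "Suc i mod l < l" using that by simp
    ultimately show ?thesis using that by (simp add: nth)
  qed
  show "tuple_edges t = edges D"
  proof (intro equalityI subsetI)
    fix e assume "e \<in> tuple_edges t"
    then obtain i j where "i < l" "j < l" "{\<phi> i, \<phi> j} \<in> edges F" "e = f ` {\<phi> i, \<phi> j}"
      by (auto simp: tuple_edges_def nth)
    then show "e \<in> edges D" unfolding f(2) by blast
  next
    fix e assume "e \<in> edges D"
    then obtain e' where e': "e' \<in> edges F" "e = f ` e'" unfolding f(2) by blast
    then obtain a b where ab: "e' = {a, b}" using F by (auto simp: simple_graph_def card_2_iff)
    then have "a \<in> \<phi> ` {..<l}" "b \<in> \<phi> ` {..<l}" using e' F \<phi>_image by (auto simp: simple_graph_def)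
    then obtain i j where "i < l" "j < l" "a = \<phi> i" "b = \<phi> j" by auto
    then have "e = {t ! i, t ! j}" "{\<phi> i, \<phi> j} \<in> edges F" using e' ab by (simp_all add: nth)
    with \<open>i < l\<close> \<open>j < l\<close> show "e \<in> tuple_edges t" unfolding tuple_edges_def by blast
  qed
qed

lemma finite_copy_tuples: "finite (verts D) \<Longrightarrow> finite (copy_tuples D)"
  by (rule finite_subset[OF _ finite_lists_length_eq[of "verts D" l]]) (auto dest: copy_tuple(1,3))

lemma finite_Aut: "finite (Aut F)"
  by (rule finite_subset[OF _ finite_permutations[OF finite_F(1)]]) (auto simp: Aut_def)

lemma card_Aut_pos: "card (Aut F) > 0"
proof -
  have "id \<in> Aut F" by (simp add: Aut_def permutes_id)
  then show ?thesis using finite_Aut by (auto simp: card_gt_0_iff)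
qed

text \<open>Composing one fixed isomorphism from \<open>F\<close> to \<open>D\<close> with the automorphisms of \<open>F\<close> gives distinct tuples.\<close>

lemma card_copy_tuples_ge:
  assumes "isomorphic F D" "finite (verts D)"
  shows "card (Aut F) \<le> card (copy_tuples D)"
proof -
  obtain f where f: "bij_betw f (verts F) (verts D)" "edges D = (\<lambda>e. f ` e) ` edges F"
    using assms by (auto simp: isomorphic_def)
  let ?t = "\<lambda>p. map (\<lambda>i. f (p (\<phi> i))) [0..<l]"
  have "inj_on ?t (Aut F)"
  proof (rule inj_onI)
    fix p q assume pq: "p \<in> Aut F" "q \<in> Aut F" "?t p = ?t q"
    then have per: "p permutes verts F" "q permutes verts F" by (auto simp: Aut_def)
    show "p = q"
    proof
      fix x show "p x = q x"
      proof (cases "x \<in> verts F")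
        case True
        then obtain i where i: "i < l" "x = \<phi> i" using \<phi>_image by auto
        then have "f (p x) = f (q x)" using arg_cong[OF pq(3), of "\<lambda>t. t ! i"] by simp
        moreover have "p x \<in> verts F" "q x \<in> verts F" using True per by (simp_all add: permutes_in_image)
        ultimately show ?thesis using f(1) by (auto simp: bij_betw_def dest: inj_onD)
      next
        case False
        then show ?thesis using per by (simp add: permutes_def)
      qed
    qed
  qed
  moreover have "?t ` Aut F \<subseteq> copy_tuples D"
  proof clarify
    fix p assume p: "p \<in> Aut F"
    then have "bij_betw p (verts F) (verts F)" by (auto simp: Aut_def intro: permutes_imp_bij)
    then have "bij_betw (f \<circ> p) (verts F) (verts D)" using f(1) by (rule bij_betw_trans)
    moreover have "(\<lambda>e. (f \<circ> p) ` e) ` edges F = edges D"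
    proof -
      have "(\<lambda>e. (f \<circ> p) ` e) ` edges F = (\<lambda>e. f ` e) ` (\<lambda>e. p ` e) ` edges F"
        by (simp add: image_image image_comp[symmetric])
      also have "(\<lambda>e. p ` e) ` edges F = edges F" using p by (simp add: Aut_def)
      finally show ?thesis using f(2) by simp
    qed
    ultimately show "?t p \<in> copy_tuples D" unfolding copy_tuples_def by (intro CollectI exI[of _ "f \<circ> p"]) simp
  qed
  ultimately show ?thesis using finite_copy_tuples[OF assms(2)] by (rule card_inj_on_le)
qed

text \<open>Each of the \<open>K\<close> copies of \<open>F\<close> in the factor can be written as a tuple in \<open>card (Aut F)\<close> ways,
independently of the others. Different choices give different sets of tuples, since the vertex set of
a tuple tells which copy it belongs to.\<close>

lemma card_factor_labellings_ge:
  fixes G :: "'b sgraph"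
  assumes G: "simple_graph G" and n: "card (verts G) = l * K" and H: "is_factor F G H"
  shows "card (Aut F) ^ K \<le> card {T \<in> tilings (edges G) l (verts G). (\<Union>t\<in>T. tuple_edges t) = edges H}"
    (is "_ \<le> card ?S")
proof -
  obtain \<D> where "\<forall>D\<in>\<D>. isomorphic F D" and dis: "disjoint_family_on verts \<D>"
    and "verts H = (\<Union>D\<in>\<D>. verts D)" and E: "edges H = (\<Union>D\<in>\<D>. edges D)"
    and "spanning_subgraph H G"
    using H unfolding is_factor_def by blast
  then have iso: "\<And>D. D \<in> \<D> \<Longrightarrow> isomorphic F D"
    and V: "verts G = (\<Union>D\<in>\<D>. verts D)" and HG: "edges H \<subseteq> edges G"
    by (simp_all add: spanning_subgraph_def)
  have finG: "finite (verts G)" using G by (simp add: simple_graph_def)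
  have cD: "card (verts D) = l" if "D \<in> \<D>" for D
    using iso[OF that] l by (auto simp: isomorphic_def dest: bij_betw_same_card)
  have finD: "finite (verts D)" "verts D \<noteq> {}" if "D \<in> \<D>" for D
    using cD[OF that] l by (auto intro!: card_ge_0_finite)
  have inj: "inj_on verts \<D>"
    using dis finD(2) by (fastforce simp: inj_on_def disjoint_family_on_def)
  have fin\<D>: "finite \<D>"
  proof (rule finite_imageD[OF _ inj])
    have "verts ` \<D> \<subseteq> Pow (verts G)" unfolding V by blast
    then show "finite (verts ` \<D>)" by (rule finite_subset) (simp add: finG)
  qed
  have "card (verts G) = (\<Sum>D\<in>\<D>. card (verts D))"
    unfolding V using fin\<D> finD dis by (intro card_UN_disjoint) (auto simp: disjoint_family_on_def)
  also have "\<dots> = l * card \<D>" using cD by simp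
  finally have card\<D>: "card \<D> = K" using n l by simp
  let ?P = "PiE \<D> copy_tuples"
  have c: "c D \<in> copy_tuples D" if "c \<in> ?P" "D \<in> \<D>" for c D using that by auto
  have inj': "inj_on (\<lambda>c. c ` \<D>) ?P"
  proof (rule inj_onI)
    fix c c' assume cc: "c \<in> ?P" "c' \<in> ?P" "c ` \<D> = c' ` \<D>"
    show "c = c'"
    proof (rule PiE_ext[OF cc(1,2)])
      fix D assume D: "D \<in> \<D>"
      then obtain D' where D': "D' \<in> \<D>" "c D = c' D'" using cc(3) by blast
      then have "verts D = verts D'" using copy_tuple(3) c[OF cc(1) D] c[OF cc(2) D'(1)] by metis
      then have "D = D'" using inj D D'(1) by (auto dest: inj_onD)
      with D' show "c D = c' D" by simp
    qed
  qed
  have sub: "(\<lambda>c. c ` \<D>) ` ?P \<subseteq> ?S"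
  proof clarify
    fix c assume cP: "c \<in> ?P"
    note t = copy_tuple[OF c[OF cP]]
    have "c ` \<D> \<subseteq> ham_tuples (edges G) l (verts G)"
    proof clarify
      fix D assume D: "D \<in> \<D>"
      have "edges D \<subseteq> edges G" "verts D \<subseteq> verts G" using D E HG V by auto
      then show "c D \<in> ham_tuples (edges G) l (verts G)"
        using t[OF D] by (auto simp: ham_tuples_def)
    qed
    moreover have "disjoint_family_on set (c ` \<D>)"
      using dis t(3) by (fastforce simp: disjoint_family_on_def)
    moreover have "(\<Union>t\<in>c ` \<D>. set t) = verts G" using t(3) V by simp
    moreover have "(\<Union>t\<in>c ` \<D>. tuple_edges t) = edges H" using t(4) E by simp
    ultimately show "c ` \<D> \<in> tilings (edges G) l (verts G) \<and> (\<Union>t\<in>c ` \<D>. tuple_edges t) = edges H"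
      by (simp add: tilings_def)
  qed
  have "card (Aut F) ^ K = (\<Prod>D\<in>\<D>. card (Aut F))" by (simp add: card\<D>)
  also have "\<dots> \<le> (\<Prod>D\<in>\<D>. card (copy_tuples D))"
    using iso finD by (intro prod_mono) (auto intro: card_copy_tuples_ge)
  also have "\<dots> = card ?P" using fin\<D> by (simp add: card_PiE)
  also have "\<dots> \<le> card ?S"
    by (rule card_inj_on_le[OF inj' sub]) (simp add: finite_tilings[OF finG])
  finally show ?thesis .
qed

text \<open>A tiling determines the edges of the factor that it labels, so the tilings belonging to different factors are different.\<close>

lemma num_factors_le_tilings:
  fixes G :: "'b sgraph"
  assumes G: "simple_graph G" and n: "card (verts G) = l * K"
  shows "num_factors F G * card (Aut F) ^ K \<le> card (tilings (edges G) l (verts G))"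
proof -
  let ?\<H> = "{H. is_factor F G H}"
  let ?S = "\<lambda>H. {T \<in> tilings (edges G) l (verts G). (\<Union>t\<in>T. tuple_edges t) = edges H}"
  have fin: "finite (tilings (edges G) l (verts G))" 
    using G by (intro finite_tilings) (simp add: simple_graph_def)
  have eq: "H = H'" if "H \<in> ?\<H>" "H' \<in> ?\<H>" "edges H = edges H'" for H H'
    using that by (auto simp: is_factor_def spanning_subgraph_def intro: prod_eqI)
  have "num_factors F G * card (Aut F) ^ K = (\<Sum>H\<in>?\<H>. card (Aut F) ^ K)"
    by (simp add: num_factors_def)
  also have "\<dots> \<le> (\<Sum>H\<in>?\<H>. card (?S H))"
    by (intro sum_mono card_factor_labellings_ge[OF G n]) simp
  also have "\<dots> = card (\<Union>H\<in>?\<H>. ?S H)"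
  proof (rule card_UN_disjoint[symmetric])
    show "finite ?\<H>" by (rule finite_factors[OF G])
    show "\<forall>H\<in>?\<H>. finite (?S H)" using fin by simp
    show "\<forall>H\<in>?\<H>. \<forall>H'\<in>?\<H>. H \<noteq> H' \<longrightarrow> ?S H \<inter> ?S H' = {}"
    proof (intro ballI impI)
      fix H H' assume "H \<in> ?\<H>" "H' \<in> ?\<H>" "H \<noteq> H'"
      then have "edges H \<noteq> edges H'" using eq by blast
      then show "?S H \<inter> ?S H' = {}" by auto
    qed
  qed
  also have "\<dots> \<le> card (tilings (edges G) l (verts G))"
    by (intro card_mono fin) auto
  finally show ?thesis .
qed

end

section \<open>Factors of complete graphs\<close>

definition complete_graph :: "'b set \<Rightarrow> 'b sgraph" where
  "complete_graph U = (U, {e. e \<subseteq> U \<and> card e = 2})"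

lemma simple_complete_graph: "finite U \<Longrightarrow> simple_graph (complete_graph U)"
  by (simp add: simple_graph_def complete_graph_def)

lemma card_le_card_image_times_fibre:
  assumes "finite A" "finite B" "f ` A \<subseteq> B" "\<And>b. b \<in> B \<Longrightarrow> card {a \<in> A. f a = b} \<le> k"
  shows "card A \<le> card B * k"
proof -
  have "A = (\<Union>b\<in>B. {a \<in> A. f a = b})" using assms(3) by auto
  then have "card A \<le> (\<Sum>b\<in>B. card {a \<in> A. f a = b})"
    using card_UN_le[OF assms(2), of "\<lambda>b. {a \<in> A. f a = b}"] by simp
  also have "\<dots> \<le> (\<Sum>b\<in>B. k)" by (intro sum_mono assms(4))
  finally show ?thesis by simp
qed

context labelled_ham_graph
begin

definition copies_on :: "'b set \<Rightarrow> 'b sgraph set" where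
  "copies_on W = {D. isomorphic F D \<and> verts D = W}"

lemma copy_edges_subset: "D \<in> copies_on W \<Longrightarrow> edges D \<subseteq> {e. e \<subseteq> W \<and> card e = 2}"
proof
  fix e assume D: "D \<in> copies_on W" and e: "e \<in> edges D"
  from D obtain f where f: "bij_betw f (verts F) W" "edges D = (\<lambda>e. f ` e) ` edges F"
    by (auto simp: copies_on_def isomorphic_def)
  from e obtain e' where e': "e' \<in> edges F" "e = f ` e'" unfolding f(2) by blast
  then have "e' \<subseteq> verts F" "card e' = 2" using F by (auto simp: simple_graph_def)
  then show "e \<in> {e. e \<subseteq> W \<and> card e = 2}"
    using e'(2) f(1) by (auto simp: bij_betw_def card_image inj_on_subset)
qed

lemma finite_copies_on: "finite W \<Longrightarrow> finite (copies_on W)"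
  by (rule finite_subset[of _ "{W} \<times> Pow (Pow W)"])
    (use copy_edges_subset in \<open>fastforce simp: copies_on_def\<close>)+

text \<open>The permutations of \<open>verts F\<close> act on the copies obtained from one fixed bijection \<open>g\<close>; two
permutations give the same copy only if they differ by an automorphism.\<close>

lemma card_copies_on_ge:
  assumes W: "finite W" "card W = l"
  shows "fact l \<le> card (copies_on W) * card (Aut F)"
proof -
  obtain g where g: "bij_betw g (verts F) W"
    using finite_same_card_bij[OF finite_F(1) W(1)] W(2) l by auto
  let ?P = "{p. p permutes verts F}"
  let ?img = "\<lambda>p. (\<lambda>e. p ` e) ` edges F"
  let ?D = "\<lambda>p. (W, (\<lambda>e. g ` e) ` ?img p)"
  have sub: "?D ` ?P \<subseteq> copies_on W"
  proof clarify
    fix p assume "p permutes verts F"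
    then have "bij_betw (g \<circ> p) (verts F) W" using g permutes_imp_bij bij_betw_trans by blast
    moreover have "(\<lambda>e. g ` e) ` ?img p = (\<lambda>e. (g \<circ> p) ` e) ` edges F"
      by (simp add: image_image image_comp[symmetric])
    ultimately show "?D p \<in> copies_on W" by (auto simp: copies_on_def isomorphic_def)
  qed
  have fibre: "card {p \<in> ?P. ?D p = D} \<le> card (Aut F)" for D
  proof (cases "{p \<in> ?P. ?D p = D} = {}")
    case False
    then obtain q where q: "q permutes verts F" "?D q = D" by blast
    have "inj_on ((\<circ>) (inv q)) {p \<in> ?P. ?D p = D}"
      using q(1) by (auto intro!: inj_onI simp: fun_eq_iff) (metis permutes_inv_eq)
    moreover have "(\<circ>) (inv q) ` {p \<in> ?P. ?D p = D} \<subseteq> Aut F"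
    proof (rule image_subsetI)
      fix p assume "p \<in> {p \<in> ?P. ?D p = D}"
      then have p: "p permutes verts F" "?D p = D" by simp_all
      from p(2) q(2) have "?D p = ?D q" by (simp only:)
      then have "(\<lambda>e. g ` e) ` ?img p = (\<lambda>e. g ` e) ` ?img q" by (simp only: prod.inject)
      moreover have "inj_on ((`) g) (Pow (verts F))"
        using g by (simp add: bij_betw_def inj_on_image_Pow)
      moreover have "?img r \<subseteq> Pow (verts F)" if "r permutes verts F" for r
        using F permutes_image[OF that] by (auto simp: simple_graph_def)
      ultimately have eq: "?img p = ?img q"
        using p(1) q(1) by (meson inj_on_image_eq_iff)
      have "(\<lambda>e. (inv q \<circ> p) ` e) ` edges F = (\<lambda>e. inv q ` e) ` ?img p"
        by (simp add: image_image image_comp[symmetric])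
      also have "\<dots> = (\<lambda>e. (inv q \<circ> q) ` e) ` edges F"
        unfolding eq by (simp add: image_image image_comp[symmetric])
      also have "\<dots> = edges F" using permutes_inv_o(2)[OF q(1)] by simp
      finally show "inv q \<circ> p \<in> Aut F"
        using permutes_compose[OF p(1) permutes_inv[OF q(1)]] by (simp add: Aut_def)
    qed
    ultimately show ?thesis using finite_Aut by (rule card_inj_on_le)
  next
    case True
    show ?thesis unfolding True by simp
  qed
  have "fact l = card ?P" using card_permutations[OF l(1)[symmetric] finite_F(1)] by simp
  also have "\<dots> \<le> card (copies_on W) * card (Aut F)"
    using finite_permutations[OF finite_F(1)] finite_copies_on[OF W(1)] sub fibre
    by (rule card_le_card_image_times_fibre)
  finally show ?thesis .
qed

lemma factor_edges_subset:
  "is_factor F (complete_graph U) H \<Longrightarrow> verts H = U \<and> edges H \<subseteq> {e. e \<subseteq> U \<and> card e = 2}"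
  by (auto simp: is_factor_def spanning_subgraph_def complete_graph_def)

lemma factor_glue:
  assumes W: "W \<subseteq> U" and D: "D \<in> copies_on W" and H: "is_factor F (complete_graph (U - W)) H"
  shows "is_factor F (complete_graph U) (U, edges D \<union> edges H)"
proof -
  obtain \<D> where \<D>: "\<forall>D\<in>\<D>. isomorphic F D" "disjoint_family_on verts \<D>"
    "verts H = (\<Union>D\<in>\<D>. verts D)" "edges H = (\<Union>D\<in>\<D>. edges D)"
    using H unfolding is_factor_def by blast
  note HU = factor_edges_subset[OF H]
  have "verts C \<inter> W = {}" if "C \<in> \<D>" for C using that \<D>(3) HU by auto
  then have "disjoint_family_on verts (insert D \<D>)"
    using \<D>(2) D by (auto simp: disjoint_family_on_def copies_on_def)
  moreover have "\<forall>C\<in>insert D \<D>. isomorphic F C" using \<D>(1) D by (simp add: copies_on_def)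
  moreover have "U = (\<Union>C\<in>insert D \<D>. verts C)" using \<D>(3) HU D W by (auto simp: copies_on_def)
  moreover have "edges D \<union> edges H = (\<Union>C\<in>insert D \<D>. edges C)" using \<D>(4) by simp
  moreover have "edges D \<union> edges H \<subseteq> {e. e \<subseteq> U \<and> card e = 2}"
    using copy_edges_subset[OF D] HU W by auto
  ultimately show ?thesis
    unfolding is_factor_def spanning_subgraph_def complete_graph_def by (auto intro!: exI[of _ "insert D \<D>"])
qed

text \<open>A Hamilton cycle connects the copy: starting at \<open>v\<close> and following the cycle one never leaves \<open>X\<close>, but meets all of \<open>W\<close>.\<close>

lemma copy_closed_subset:
  assumes D: "D \<in> copies_on W" and W: "finite W" and v: "v \<in> W" "v \<in> X"
    and closed: "\<And>a b. {a, b} \<in> edges D \<Longrightarrow> a \<in> X \<Longrightarrow> b \<in> X"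
  shows "W \<subseteq> X"
proof -
  have "card (copy_tuples D) > 0"
    using card_copy_tuples_ge[of D] card_Aut_pos D W by (auto simp: copies_on_def)
  then obtain t where "t \<in> copy_tuples D" by (metis card.empty equals0I less_irrefl)
  note t = copy_tuple[OF this]
  have tW: "set t = W" using t(3) D by (simp add: copies_on_def)
  obtain i where i: "i < l" "t ! i = v" using v(1) t(1) tW by (metis in_set_conv_nth)
  have X: "t ! ((i + j) mod l) \<in> X" for j
  proof (induction j)
    case 0
    show ?case using i v(2) by simp
  next
    case (Suc j)
    have "{t ! ((i + j) mod l), t ! (Suc ((i + j) mod l) mod l)} \<in> edges D"
      using l by (intro t(5)) simp
    from closed[OF this Suc.IH] show ?case by (simp add: mod_Suc_eq)
  qed
  show ?thesis
  proof
    fix w assume "w \<in> W"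
    then obtain m where m: "m < l" "t ! m = w" using t(1) tW by (metis in_set_conv_nth)
    \<comment> \<open>Walk on from position \<open>i\<close> to position \<open>m\<close>; adding \<open>l\<close> avoids truncated subtraction.\<close>
    have "(i + (m + l - i)) mod l = m" using m(1) i(1) by simp
    then show "w \<in> X" using X[of "m + l - i"] m(2) by simp
  qed
qed

text \<open>The factor determines the copy that contains \<open>v\<close>, because this copy is the connected component of
\<open>v\<close>: no edge of the rest meets it, and its Hamilton cycle reaches all of it from \<open>v\<close>.\<close>

lemma glue_determines:
  assumes fin: "finite U" and v: "v \<in> W" "v \<in> W'"
    and D: "D \<in> copies_on W" "D' \<in> copies_on W'" "W \<subseteq> U" "W' \<subseteq> U"
    and H: "is_factor F (complete_graph (U - W)) H" "is_factor F (complete_graph (U - W')) H'"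
    and eq: "edges D \<union> edges H = edges D' \<union> edges H'"
  shows "W = W' \<and> D = D' \<and> H = H'"
proof -
  have aux: "W1 \<subseteq> W2" if "v \<in> W1" "v \<in> W2" "D1 \<in> copies_on W1" "D2 \<in> copies_on W2" "W1 \<subseteq> U"
    "is_factor F (complete_graph (U - W2)) H2" "edges D1 \<union> edges H1 = edges D2 \<union> edges H2"
    for W1 W2 D1 D2 H1 H2
  proof (rule copy_closed_subset[OF that(3) _ that(1,2)])
    show "finite W1" using that(5) fin finite_subset by blast
    fix a b assume "{a, b} \<in> edges D1" "a \<in> W2"
    then have "{a, b} \<in> edges D2" using that(7) factor_edges_subset[OF that(6)] by blast
    then show "b \<in> W2" using copy_edges_subset[OF that(4)] by blast
  qed
  have WW: "W = W'"
    using aux[OF v D(1,2,3) H(2) eq] aux[OF v(2,1) D(2,1,4) H(1) eq[symmetric]] by blast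
  have part: "edges D1 = {e \<in> edges D1 \<union> edges H1. e \<subseteq> W} \<and> edges H1 = {e \<in> edges D1 \<union> edges H1. \<not> e \<subseteq> W}"
    if "D1 \<in> copies_on W" "is_factor F (complete_graph (U - W)) H1" for D1 H1
  proof -
    have "\<not> e \<subseteq> W" if "e \<in> edges H1" for e
    proof -
      have "e \<subseteq> U - W" "card e = 2" using that factor_edges_subset[OF \<open>is_factor F _ H1\<close>] by auto
      then show ?thesis by (cases "e = {}") auto
    qed
    then show ?thesis using copy_edges_subset[OF that(1)] by blast
  qed
  have "edges D = edges D'" "edges H = edges H'"
    using part[OF D(1) H(1)] part[OF D(2)[folded WW] H(2)[folded WW]] eq by auto
  moreover have "verts D = verts D'" "verts H = verts H'"
    using D(1,2) WW factor_edges_subset[OF H(1)] factor_edges_subset[OF H(2)]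
    by (auto simp: copies_on_def)
  ultimately show ?thesis using WW by (simp add: prod_eq_iff)
qed

text \<open>Fix a vertex \<open>v\<close>, choose the vertex set \<open>W\<close> of its copy, a copy on \<open>W\<close> and a factor of the rest. With
\<open>n = l * (K + 1)\<close> the numbers fit together because
\<open>(K + 1) * ((n - 1) choose (l - 1)) * fact l * fact (n - l) = fact n\<close>.\<close>

lemma num_factors_complete_ge:
  assumes "finite U" "card U = l * K"
  shows "fact (l * K) \<le> num_factors F (complete_graph U) * card (Aut F) ^ K * fact K"
  using assms
proof (induction K arbitrary: U)
  case 0
  then have "U = {}" by simp
  have "is_factor F (complete_graph U) ({}, {})"
    unfolding is_factor_def spanning_subgraph_def complete_graph_def
    by (intro conjI exI[of _ "{}"]) (auto simp: \<open>U = {}\<close> disjoint_family_on_def)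
  then have "num_factors F (complete_graph U) > 0"
    using finite_factors[OF simple_complete_graph[OF 0(1)], of F]
    by (auto simp: num_factors_def card_gt_0_iff)
  then show ?case by simp
next
  case (Suc K)
  let ?N = "\<lambda>U. num_factors F (complete_graph U)"
  let ?a = "card (Aut F)"
  define n where "n = l * Suc K"
  have nl: "l \<le> n" "n - l = l * K" "n > 0" using l by (simp_all add: n_def)
  obtain v where v: "v \<in> U" using Suc.prems l by fastforce
  define \<W> where "\<W> = {W. W \<subseteq> U \<and> v \<in> W \<and> card W = l}"
  have fin\<W>: "finite \<W>" using Suc.prems by (simp add: \<W>_def)
  have W: "W \<subseteq> U" "v \<in> W" "card W = l" "finite W" if "W \<in> \<W>" for W
    using that Suc.prems finite_subset by (auto simp: \<W>_def)
  have card\<W>: "(n - 1) choose (l - 1) \<le> card \<W>"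
  proof -
    have "(n - 1) choose (l - 1) = card {B. B \<subseteq> U - {v} \<and> card B = l - 1}"
      using n_subsets[of "U - {v}" "l - 1"] Suc.prems v by (simp add: n_def)
    also have "\<dots> \<le> card \<W>"
    proof (rule card_inj_on_le)
      show "inj_on (insert v) {B. B \<subseteq> U - {v} \<and> card B = l - 1}"
        by (rule inj_onI) (auto dest!: insert_ident[THEN iffD1, rotated -1])
      show "insert v ` {B. B \<subseteq> U - {v} \<and> card B = l - 1} \<subseteq> \<W>"
      proof clarify
        fix B assume B: "B \<subseteq> U - {v}" "card B = l - 1"
        then have "finite B" "v \<notin> B" using Suc.prems finite_subset by auto
        then show "insert v B \<in> \<W>" using B v l by (auto simp: \<W>_def)
      qed
    qed (rule fin\<W>)
    finally show ?thesis .
  qed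
  define pieces where "pieces = (\<lambda>W. copies_on W \<times> {H. is_factor F (complete_graph (U - W)) H})"
  have finp: "finite (pieces W)" if "W \<in> \<W>" for W
    using W[OF that] Suc.prems
    by (auto simp: pieces_def intro!: finite_cartesian_product finite_copies_on finite_factors simple_complete_graph)
  have step: "fact l * fact (l * K) \<le> card (pieces W) * (?a ^ Suc K * fact K)" if "W \<in> \<W>" for W
  proof -
    have "card (U - W) = l * K" using W[OF that] Suc.prems by (simp add: card_Diff_subset)
    then have "fact (l * K) \<le> ?N (U - W) * ?a ^ K * fact K"
      using Suc.prems by (intro Suc.IH) auto
    from mult_le_mono[OF card_copies_on_ge[OF W(4,3)[OF that]] this]
    show ?thesis by (simp add: pieces_def card_cartesian_product num_factors_def mult_ac)
  qed
  have "card (SIGMA W:\<W>. pieces W) \<le> ?N U"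
    unfolding num_factors_def
  proof (rule card_inj_on_le[of "\<lambda>(W, D, H). (U, edges D \<union> edges H)"])
    show "inj_on (\<lambda>(W, D, H). (U, edges D \<union> edges H)) (SIGMA W:\<W>. pieces W)"
    proof (rule inj_onI)
      fix x y assume xy: "x \<in> (SIGMA W:\<W>. pieces W)" "y \<in> (SIGMA W:\<W>. pieces W)"
        "(case x of (W, D, H) \<Rightarrow> (U, edges D \<union> edges H)) = (case y of (W, D, H) \<Rightarrow> (U, edges D \<union> edges H))"
      obtain W D H W' D' H' where x: "x = (W, D, H)" and y: "y = (W', D', H')"
        by (metis prod_cases3)
      have *: "W \<in> \<W>" "(D, H) \<in> pieces W" "W' \<in> \<W>" "(D', H') \<in> pieces W'"
        "edges D \<union> edges H = edges D' \<union> edges H'"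
        using xy unfolding x y by simp_all
      have "W = W' \<and> D = D' \<and> H = H'"
        by (rule glue_determines[OF Suc.prems(1) W(2)[OF *(1)] W(2)[OF *(3)] _ _ W(1)[OF *(1)] W(1)[OF *(3)] _ _ *(5)])
          (use *(2,4) in \<open>simp_all add: pieces_def\<close>)
      then show "x = y" by (simp add: x y)
    qed
    show "(\<lambda>(W, D, H). (U, edges D \<union> edges H)) ` (SIGMA W:\<W>. pieces W) \<subseteq> {H. is_factor F (complete_graph U) H}"
    proof (rule image_subsetI)
      fix x assume x: "x \<in> (SIGMA W:\<W>. pieces W)"
      obtain W D H where "x = (W, D, H)" by (rule prod_cases3)
      with x factor_glue[of W U D H] W(1)[of W]
      show "(case x of (W, D, H) \<Rightarrow> (U, edges D \<union> edges H)) \<in> {H. is_factor F (complete_graph U) H}"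
        by (simp add: pieces_def)
    qed
    show "finite {H. is_factor F (complete_graph U) H}"
      by (rule finite_factors[OF simple_complete_graph[OF Suc.prems(1)]])
  qed
  then have sumN: "(\<Sum>W\<in>\<W>. card (pieces W)) \<le> ?N U"
    using fin\<W> finp by (subst (asm) card_SigmaI) auto
  have "card \<W> * (fact l * fact (l * K)) = (\<Sum>W\<in>\<W>. fact l * fact (l * K))" by simp
  also have "\<dots> \<le> (\<Sum>W\<in>\<W>. card (pieces W) * (?a ^ Suc K * fact K))"
    by (rule sum_mono) (rule step)
  also have "\<dots> = (\<Sum>W\<in>\<W>. card (pieces W)) * (?a ^ Suc K * fact K)"
    by (simp only: sum_distrib_right)
  also have "\<dots> \<le> ?N U * (?a ^ Suc K * fact K)"
    using sumN by (rule mult_right_mono) simp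
  finally have pieces_le: "card \<W> * (fact l * fact (l * K)) \<le> ?N U * (?a ^ Suc K * fact K)" .
  have "fact n = n * (fact (l - 1) * fact (n - l) * ((n - 1) choose (l - 1)))"
  proof -
    have "fact (l - 1) * fact (n - 1 - (l - 1)) * ((n - 1) choose (l - 1)) = fact (n - 1)"
      using nl l by (intro binomial_fact_lemma) simp
    moreover have "n - 1 - (l - 1) = n - l" using nl l by simp
    moreover have "fact n = n * fact (n - 1)" using nl by (simp add: fact_reduce)
    ultimately show ?thesis by simp
  qed
  also have "\<dots> = Suc K * (((n - 1) choose (l - 1)) * (fact l * fact (l * K)))"
  proof -
    have "fact l = l * fact (l - 1)" using l by (simp add: fact_reduce)
    then show ?thesis unfolding nl(2) by (simp add: n_def mult_ac del: mult_Suc mult_Suc_right)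
  qed
  also have "\<dots> \<le> Suc K * (card \<W> * (fact l * fact (l * K)))"
    using card\<W> by (intro mult_le_mono) auto
  also have "\<dots> \<le> Suc K * (?N U * (?a ^ Suc K * fact K))"
    using pieces_le by (rule mult_left_mono) simp
  also have "\<dots> = ?N U * ?a ^ Suc K * fact (Suc K)" by (simp add: algebra_simps)
  finally show ?case by (simp only: n_def)
qed

end

section \<open>The extremal number\<close>

text \<open>Both bounds have this shape with \<open>a = l / card (Aut F)\<close>; the root of order \<open>l - 1\<close> in the density
cancels against the exponent \<open>(1 - 1 / l) n = (l - 1) K\<close>.\<close>

lemma density_powr:
  fixes a c x :: real
  assumes "2 \<le> l" "a > 0" "c > 0" "x > 0"
  shows "(c * a powr (1 / (real l - 1)) * x) powr ((1 - 1 / real l) * real (l * K))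
    = a ^ K * (c * x) ^ ((l - 1) * K)"
proof -
  let ?r = "a powr (1 / (real l - 1))"
  have l1: "real l - 1 \<noteq> 0" "real (l - 1) = real l - 1" using assms by (simp_all add: of_nat_diff)
  have "(1 - 1 / real l) * real (l * K) = real ((l - 1) * K)"
    using assms l1 by (simp add: algebra_simps)
  then have "(c * ?r * x) powr ((1 - 1 / real l) * real (l * K))
      = (c * ?r * x) powr real ((l - 1) * K)" by (simp only:)
  also have "\<dots> = (c * ?r * x) ^ ((l - 1) * K)"
    using assms by (intro powr_realpow mult_pos_pos) auto
  also have "\<dots> = ?r ^ ((l - 1) * K) * (c * x) ^ ((l - 1) * K)"
    by (simp add: power_mult_distrib mult_ac)
  also have "?r ^ ((l - 1) * K) = a ^ K"
  proof -
    have "?r ^ (l - 1) = ?r powr (real l - 1)"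
      using assms l1 by (simp add: powr_realpow[symmetric])
    also have "\<dots> = a" using assms l1 by (simp add: powr_powr)
    finally show ?thesis by (simp add: power_mult)
  qed
  finally show ?thesis .
qed

lemma two_times_choose_two: "2 * real (n choose 2) = real n * (real n - 1)"
proof -
  have "2 * (n choose 2) = n * (n - 1)" unfolding choose_two by (intro dvd_mult_div_cancel) auto
  then have "real (2 * (n choose 2)) = real (n * (n - 1))" by (simp only:)
  then show ?thesis by (cases n) (simp_all add: algebra_simps)
qed

lemma card_edges_le_choose:
  assumes "simple_graph G"
  shows "card (edges G) \<le> card (verts G) choose 2"
proof -
  have fin: "finite (verts G)" using assms by (simp add: simple_graph_def)
  have "edges G \<subseteq> {e. e \<subseteq> verts G \<and> card e = 2}" using assms by (auto simp: simple_graph_def)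
  then have "card (edges G) \<le> card {e. e \<subseteq> verts G \<and> card e = 2}"
    by (rule card_mono[rotated]) (simp add: fin)
  then show ?thesis by (simp add: n_subsets[OF fin])
qed

context labelled_ham_graph
begin

text \<open>Dividing the bound on tilings by \<open>card (Aut F) ^ K\<close> gives the factor \<open>(l / card (Aut F)) ^ K\<close>.\<close>

lemma num_factors_upper:
  fixes G :: "'b sgraph" and c d y :: real
  assumes G: "simple_graph G" "card (verts G) = l * K" "edges G \<noteq> {}" and K: "K > 0" and c: "c > 0"
    and d: "d = 2 * real (card (edges G)) / real (l * K)" and y: "y = real l / d + 1 / real K"
    and small: "(1 + y) * ln (1 + y) - y * ln y \<le> ln c"
  shows "real (num_factors F G) \<le> (real l / real (card (Aut F))) ^ K * (c * (d / exp 1)) ^ ((l - 1) * K)"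
proof -
  have E: "finite (edges G)" "finite (verts G)" "\<And>e. e \<in> edges G \<Longrightarrow> card e = 2"
    using G simple_graph_finite_edges[OF G(1)] by (simp_all add: simple_graph_def)
  then have m: "card (edges G) > 0" using G(3) by (simp add: card_gt_0_iff)
  have dpos: "d > 0" unfolding d using m l K by simp
  have A: "real (card (Aut F)) > 0" using card_Aut_pos by simp
  have l0: "0 < l" using l by simp
  have "real (num_factors F G) * real (card (Aut F)) ^ K \<le> real (card (tilings (edges G) l (verts G)))"
    using num_factors_le_tilings[OF G(1,2)] by (metis of_nat_le_iff of_nat_mult of_nat_power)
  also have "\<dots> \<le> real l ^ K * (\<Prod>j<K. real l + real j *
      (2 * real (card (edges G)) / (real l * real K * (real K - 1)))) ^ (l - 1)"
    by (rule card_tilings_le[OF E(2) l0 G(2) E(1,3)])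
  also have "2 * real (card (edges G)) / (real l * real K * (real K - 1)) = d / (real K - 1)"
    by (simp add: d)
  also have "real l ^ K * (\<Prod>j<K. real l + real j * (d / (real K - 1))) ^ (l - 1)
      \<le> real l ^ K * ((c * (d / exp 1)) ^ K) ^ (l - 1)"
  proof (intro mult_left_mono power_mono)
    show "(\<Prod>j<K. real l + real j * (d / (real K - 1))) \<le> (c * (d / exp 1)) ^ K"
      using K dpos c y small by (rule prod_arithmetic_le)
    have "0 \<le> d / (real K - 1)" using dpos K by (cases K) auto
    then show "0 \<le> (\<Prod>j<K. real l + real j * (d / (real K - 1)))"
      by (intro prod_nonneg add_nonneg_nonneg mult_nonneg_nonneg) auto
  qed simp
  also have "((c * (d / exp 1)) ^ K) ^ (l - 1) = (c * (d / exp 1)) ^ ((l - 1) * K)"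
    by (simp only: power_mult[symmetric] mult.commute)
  finally show ?thesis using A by (simp add: power_divide divide_simps mult_ac)
qed

text \<open>By Stirling \<open>fact n / fact K\<close> is \<open>l ^ K * (n / e) ^ ((l - 1) K)\<close> up to a factor linear in \<open>K\<close>, which the
exponentially small \<open>q ^ K\<close> compensates.\<close>

lemma num_factors_complete_lower:
  fixes U :: "'b set" and q :: real
  assumes U: "finite U" "card U = l * K" and K: "K > 0" and q: "0 < q" "q \<le> 1"
    and small: "exp 1 * real K * q ^ K \<le> 1"
  shows "(real l / real (card (Aut F))) ^ K * (q * ((real (l * K) - 1) / exp 1)) ^ ((l - 1) * K)
    \<le> real (num_factors F (complete_graph U))"
proof -
  let ?N = "real (num_factors F (complete_graph U))" and ?A = "real (card (Aut F))"
  let ?n = "real (l * K)" and ?M = "(l - 1) * K"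
  have A: "?A > 0" using card_Aut_pos by simp
  have "1 \<le> l * K" using l(2) K by simp
  from of_nat_mono[OF this, where 'a = real] have n1: "1 \<le> ?n" by (simp only: of_nat_1)
  have "l - 1 + 1 = l" using l(2) by simp
  then have M: "l * K = ?M + K" by (metis distrib_right mult_1)
  have pos: "(real K / exp 1) ^ K > 0" using K by simp
  have "(?n / exp 1) ^ ?M * real l ^ K * (real K / exp 1) ^ K = (?n / exp 1) ^ (l * K)"
  proof -
    have "(?n / exp 1) ^ K = real l ^ K * (real K / exp 1) ^ K"
      by (simp add: power_mult_distrib[symmetric])
    moreover have "(?n / exp 1) ^ (l * K) = (?n / exp 1) ^ ?M * (?n / exp 1) ^ K"
      using power_add[of "?n / exp 1" ?M K] M by (simp only:)
    ultimately show ?thesis by (simp only: mult.assoc)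
  qed
  also have "\<dots> \<le> fact (l * K)" by (rule power_le_fact)
  also have "\<dots> \<le> ?N * ?A ^ K * fact K"
  proof -
    have "real (fact (l * K)) \<le> real (num_factors F (complete_graph U) * card (Aut F) ^ K * fact K)"
      using num_factors_complete_ge[OF U] by (simp only: of_nat_le_iff)
    then show ?thesis by simp
  qed
  also have "\<dots> \<le> ?N * ?A ^ K * (exp 1 * real K * (real K / exp 1) ^ K)"
    using fact_le_power[OF K] by (intro mult_left_mono) auto
  finally have "((?n / exp 1) ^ ?M * real l ^ K) * (real K / exp 1) ^ K
      \<le> (?N * ?A ^ K * (exp 1 * real K)) * (real K / exp 1) ^ K" by (simp only: mult_ac)
  then have "(?n / exp 1) ^ ?M * real l ^ K \<le> ?N * ?A ^ K * (exp 1 * real K)"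
    using pos by (rule mult_right_le_imp_le)
  then have key: "(real l / ?A) ^ K * (?n / exp 1) ^ ?M \<le> ?N * (exp 1 * real K)"
    using A by (simp add: power_divide divide_simps mult_ac)
  have "(real l / ?A) ^ K * (q * ((?n - 1) / exp 1)) ^ ?M = (real l / ?A) ^ K * ((?n - 1) / exp 1) ^ ?M * q ^ ?M"
    by (simp only: power_mult_distrib mult_ac)
  also have "\<dots> \<le> (real l / ?A) ^ K * (?n / exp 1) ^ ?M * q ^ K"
  proof (intro mult_mono power_mono divide_right_mono)
    have "K \<le> ?M" using l by (cases "l - 1") auto
    then show "q ^ ?M \<le> q ^ K" using q by (intro power_decreasing) auto
  qed (use n1 q in \<open>auto intro!: mult_nonneg_nonneg zero_le_power divide_nonneg_nonneg\<close>)
  also have "\<dots> \<le> ?N * (exp 1 * real K) * q ^ K"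
    using q by (intro mult_right_mono[OF key]) auto
  also have "\<dots> = ?N * (exp 1 * real K * q ^ K)" by (simp only: mult_ac)
  also have "\<dots> \<le> ?N * 1" by (intro mult_left_mono small) auto
  finally show ?thesis by simp
qed

end

theorem corollary1p6:
  fixes F :: "'a sgraph" and \<epsilon> :: real
  assumes "\<epsilon> > 0" and "simple_graph F" and "hamiltonian F"
  shows "\<exists>C>0::real.
    (\<forall>n m :: nat. n > 0 \<longrightarrow> m > 0 \<longrightarrow> card (verts F) dvd n \<longrightarrow> real m \<ge> C * real n \<longrightarrow>
       real (max_factors F n m) \<le>
         ((1 + \<epsilon>) * (real (card (verts F)) / real (card (Aut F))) powr (1 / (real (card (verts F)) - 1))
            * (2 * real m / (exp 1 * real n))) powr ((1 - 1 / real (card (verts F))) * real n)) \<and>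
    (\<forall>\<delta>::real. 0 < \<delta> \<longrightarrow> \<delta> < 1 \<longrightarrow>
       infinite {(n :: nat, m :: nat). n > 0 \<and> m > 0 \<and> card (verts F) dvd n \<and> real m \<ge> C * real n \<and>
         real (max_factors F n m) \<ge>
           ((1 - \<delta>) * (real (card (verts F)) / real (card (Aut F))) powr (1 / (real (card (verts F)) - 1))
              * (2 * real m / (exp 1 * real n))) powr ((1 - 1 / real (card (verts F))) * real n)})"
proof -
  define l where "l = card (verts F)"
  have l2: "2 \<le> l" using assms(3) by (simp add: hamiltonian_def l_def)
  obtain \<phi> where "bij_betw \<phi> {..<l} (verts F)" "\<And>i. i < l \<Longrightarrow> {\<phi> i, \<phi> (Suc i mod l)} \<in> edges F"
    using hamiltonian_labelling[OF assms(3)] by (auto simp: l_def)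
  then interpret labelled_ham_graph F l \<phi>
    using assms(2) l2 by unfold_locales (simp_all add: l_def)
  let ?a = "real l / real (card (Aut F))"
  have a: "?a > 0" using l2 card_Aut_pos by simp
  obtain y0 :: real where y0: "y0 > 0"
    and small: "\<And>y. 0 < y \<Longrightarrow> y < y0 \<Longrightarrow> (1 + y) * ln (1 + y) - y * ln y \<le> ln (1 + \<epsilon>)"
    using entropy_term_small[OF assms(1)] by blast
  \<comment> \<open>Large enough for the error term \<open>y = l / d + 1 / K\<close> to stay below \<open>y0\<close>: the average degree
    \<open>d\<close> is at least \<open>2 C\<close>, and \<open>1 / K\<close> is at most \<open>l / d\<close> since \<open>d\<close> is at most \<open>n = l K\<close>.\<close>
  define C where "C = 2 * real l / y0"
  have C: "C > 0" using y0 l2 by (simp add: C_def)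
  have upper: "real (max_factors F n m) \<le>
      ((1 + \<epsilon>) * ?a powr (1 / (real l - 1)) * (2 * real m / (exp 1 * real n))) powr ((1 - 1 / real l) * real n)"
    if nm: "n > 0" "m > 0" "l dvd n" "real m \<ge> C * real n" for n m
  proof (cases "factor_counts F n m = {}")
    case False
    then have "max_factors F n m \<in> factor_counts F n m"
      using finite_factor_counts[of F n m] by (simp add: max_factors_def)
    then obtain G :: "nat sgraph" where G: "simple_graph G" "card (verts G) = n" "card (edges G) = m"
      and N: "max_factors F n m = num_factors F G"
      by (auto simp: factor_counts_def)
    obtain K where K: "n = l * K" using nm(3) by (elim dvdE)
    have K0: "K > 0" using nm(1) K by simp
    define d where "d = 2 * real m / real (l * K)"
    define y where "y = real l / d + 1 / real K"
    have dC: "d \<ge> 2 * C" using nm K by (simp add: d_def field_simps)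
    have "2 * real m \<le> 2 * real (n choose 2)" using card_edges_le_choose[OF G(1)] G by simp
    also have "\<dots> \<le> real n * real n" unfolding two_times_choose_two by (simp add: mult_left_mono)
    finally have "d \<le> real l * real K" using nm(1) K by (simp add: d_def divide_le_eq)
    moreover have dpos: "d > 0" using dC C by simp
    ultimately have "1 / real K \<le> real l / d" using K0 by (simp add: field_simps)
    moreover have "2 * (real l / d) \<le> y0 / 2"
    proof -
      have "2 * (real l / d) \<le> 2 * (real l / (2 * C))"
        using dC C by (intro mult_left_mono divide_left_mono) auto
      also have "\<dots> = y0 / 2" using y0 l2 by (simp add: C_def)
      finally show ?thesis .
    qed
    ultimately have "y < y0" "y > 0" using y0 dpos K0 by (auto simp: y_def add_nonneg_pos)
    from small[OF this(2,1)]
    have "real (num_factors F G) \<le> ?a ^ K * ((1 + \<epsilon>) * (d / exp 1)) ^ ((l - 1) * K)"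
      using G K K0 assms(1) nm(2) by (intro num_factors_upper[OF G(1) _ _ _ _ _ y_def]) (auto simp: d_def)
    also have "\<dots> = ((1 + \<epsilon>) * ?a powr (1 / (real l - 1)) * (d / exp 1)) powr ((1 - 1 / real l) * real (l * K))"
      using l2 a assms(1) dpos by (intro density_powr[symmetric]) auto
    finally show ?thesis unfolding N by (simp add: K d_def mult_ac)
  qed (simp add: max_factors_def)
  \<comment> \<open>The complete graphs on \<open>l K\<close> vertices, for all large \<open>K\<close>, attain the bound up to \<open>1 - \<delta>\<close>.\<close>
  have sharp: "infinite {(n, m). n > 0 \<and> m > 0 \<and> l dvd n \<and> real m \<ge> C * real n \<and>
      real (max_factors F n m) \<ge>
        ((1 - \<delta>) * ?a powr (1 / (real l - 1)) * (2 * real m / (exp 1 * real n))) powr ((1 - 1 / real l) * real n)}"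
    (is "infinite ?S") if \<delta>: "0 < \<delta>" "\<delta> < 1" for \<delta> :: real
  proof -
    have "(\<lambda>K. exp 1 * (real K * (1 - \<delta>) ^ K)) \<longlonglongrightarrow> exp 1 * 0"
      using \<delta> by (intro tendsto_mult tendsto_const powser_times_n_limit_0) simp
    then have "\<forall>\<^sub>F K in sequentially. exp 1 * (real K * (1 - \<delta>) ^ K) < 1"
      by (rule order_tendstoD) simp
    then obtain K1 where K1: "\<And>K. K \<ge> K1 \<Longrightarrow> exp 1 * (real K * (1 - \<delta>) ^ K) < 1"
      by (auto simp: eventually_sequentially)
    \<comment> \<open>\<open>K1\<close> makes \<open>(1 - \<delta>) ^ K\<close> compensate the Stirling error, the other bound ensures \<open>m \<ge> C n\<close>.\<close>
    define K0 where "K0 = max K1 (nat \<lceil>2 * C + 1\<rceil>)"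
    have "(\<lambda>K. (l * K, l * K choose 2)) ` {K0..} \<subseteq> ?S"
    proof (rule image_subsetI)
      fix K assume "K \<in> {K0..}"
      then have K: "K \<ge> K1" and "nat \<lceil>2 * C + 1\<rceil> \<le> K" by (simp_all add: K0_def)
      then have KC: "2 * C + 1 \<le> real K" by linarith
      have Kpos: "K > 0" using KC C by (cases "K = 0") auto
      let ?n = "l * K"
      let ?G = "complete_graph {..<?n}"
      have "K \<le> ?n" using l2 by simp
      then have "real K \<le> real ?n" by (simp only: of_nat_le_iff)
      with KC C have n: "2 * C \<le> real ?n - 1" "0 < real ?n - 1" by linarith+
      have m: "real (?n choose 2) = real ?n * (real ?n - 1) / 2"
        using two_times_choose_two[of ?n] by simp
      have "real (?n choose 2) > 0" unfolding m using n by (intro divide_pos_pos mult_pos_pos) linarith+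
      moreover have "real (?n choose 2) \<ge> C * real ?n"
      proof -
        have "real ?n * (2 * C) \<le> real ?n * (real ?n - 1)" using n(1) by (rule mult_left_mono) simp
        then have "real ?n * (2 * C) / 2 \<le> real (?n choose 2)"
          unfolding m by (rule divide_right_mono) simp
        moreover have "real ?n * (2 * C) / 2 = C * real ?n" by simp
        ultimately show ?thesis by (simp only:)
      qed
      moreover have "real (max_factors F ?n (?n choose 2)) \<ge>
        ((1 - \<delta>) * ?a powr (1 / (real l - 1)) * (2 * real (?n choose 2) / (exp 1 * real ?n)))
          powr ((1 - 1 / real l) * real ?n)"
      proof -
        have "2 * real (?n choose 2) / (exp 1 * real ?n) = (real ?n - 1) / exp 1"
          unfolding m using l2 Kpos by simp
        then have "((1 - \<delta>) * ?a powr (1 / (real l - 1)) * (2 * real (?n choose 2) / (exp 1 * real ?n)))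
            powr ((1 - 1 / real l) * real ?n) = ?a ^ K * ((1 - \<delta>) * ((real ?n - 1) / exp 1)) ^ ((l - 1) * K)"
          using l2 a \<delta> n by (simp only: density_powr) (subst density_powr; simp)
        also have "\<dots> \<le> real (num_factors F ?G)"
          using K1[OF K] \<delta> Kpos by (intro num_factors_complete_lower) (auto simp: mult_ac)
        also have "num_factors F ?G \<in> factor_counts F ?n (?n choose 2)"
          unfolding factor_counts_def
          by (intro CollectI exI[of _ ?G] conjI refl simple_complete_graph)
            (simp_all add: complete_graph_def n_subsets)
        then have "num_factors F ?G \<le> max_factors F ?n (?n choose 2)"
          using finite_factor_counts[of F ?n "?n choose 2"] by (auto simp: max_factors_def)
        finally show ?thesis by simp
      qed
      ultimately show "(?n, ?n choose 2) \<in> ?S" using l2 Kpos by simp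
    qed
    moreover have "infinite ((\<lambda>K. (l * K, l * K choose 2)) ` {K0..})"
      using l2 by (subst finite_image_iff) (auto simp: inj_on_def infinite_Ici)
    ultimately show ?thesis using finite_subset by blast
  qed
  show ?thesis
    unfolding l_def[symmetric] using C upper sharp by blast
qed

end
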